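(* Let $X\subseteq\{0,1\}^n$, $f:X\to\{0,1\}$, and let $\{\ket{v_{x,j}}\in\mathbb{C}^m\}_{x\in X,j\in[n]}$ be any family of vectors with size $A=\max_{x\in X}\sum_j\|\ket{v_{x,j}}\|^2\ge 1$. With $c=100$, define for $f(x)=1$ the unit vector $\ket{\psi_x}=\frac{1}{\sqrt{\nu_x}}\big(\ket{\hat0}+\frac{1}{\sqrt{cA}}\sum_{i\in[n]}\ket{i}\ket{v_{x,i}}\ket{x_i}\big)$, $\nu_x=1+\frac{1}{cA}\sum_i\|\ket{v_{x,i}}\|^2$, and for $f(x)=0$ the unit vector $\ket{\phi_x}=\frac{1}{\sqrt{\mu_x}}\big(\ket{\hat0}-\sqrt{cA}\sum_{i\in[n]}\ket{i}\ket{v_{x,i}}\ket{\bar x_i}\big)$, $\mu_x=1+cA\sum_i\|\ket{v_{x,i}}\|^2$, where $\bar x_i=1-x_i$. Let $\varepsilon=\max_{x,y:f(x)\ne f(y)}|\braket{\psi_x}{\phi_y}|$ (with $x\in f^{-1}(1)$, $y\in f^{-1}(0)$). Let $M$ be the matrix whose rows are $\bra{\psi_x}$ for $x\in f^{-1}(1)$, with nonzero singular values $s_1\ge s_2\ge\cdots\ge s_\kappa>0$ ($\kappa=\operatorname{rank}M$), set $s_{\kappa+1}=0$, and let $n_1=|f^{-1}(1)|$. If there exists $\kappa^*\in[\kappa]$ such that $$\varepsilon\le\frac{1}{\sqrt{n_1}}\left(\frac{s_{\kappa^*}}{2\sqrt{c}A}-s_{\kappa^*+1}\right)\quad\text{and}\quad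 s_{\kappa^*+1}\le\frac{1}{2\sqrt{1000c}\,A},$$ then there is a quantum query algorithm that evaluates $f(x)$ correctly with probability at least $2/3$ for every $x\in X$, using $O(A)$ queries and $O(\log(nm))$ qubits.
   Context: Vectors live in $\mathcal{H}=\mathbb{C}\oplus(\mathbb{C}^n\otimes\mathbb{C}^m\otimes\mathbb{C}^2)$, where $\ket{\hat0}$ is a unit vector spanning the first summand. A quantum query algorithm has the form $U_TO_xU_{T-1}O_x\cdots U_1O_xU_0\ket{\hat0}$ followed by a two-outcome measurement, with $x$-independent unitaries $U_t$ on a Hilbert space of dimension $S$ and oracle $O_x\ket{i}\ket{b}=\ket{i}\ket{b\oplus x_i}$; it uses $T$ queries and $\log S$ qubits. *)

theory Defs
  imports "Jordan_Normal_Form.Char_Poly" "HOL-Library.List_Lexorder"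
begin

definition adj :: "complex mat \<Rightarrow> complex mat" where
  "adj A = mat (dim_col A) (dim_row A) (\<lambda>(i,j). cnj (A $$ (j,i)))"

definition unitary_mat :: "nat \<Rightarrow> complex mat \<Rightarrow> bool" where
  "unitary_mat S U \<longleftrightarrow> U \<in> carrier_mat S S \<and> adj U * U = 1\<^sub>m S"

text \<open>orthogonal projection = two-outcome projective measurement {P, I - P}\<close>
definition projector :: "nat \<Rightarrow> complex mat \<Rightarrow> bool" where
  "projector S P \<longleftrightarrow> P \<in> carrier_mat S S \<and> adj P = P \<and> P * P = P"

definition vnorm2 :: "complex vec \<Rightarrow> real" where
  "vnorm2 v = (\<Sum>i<dim_vec v. (cmod (v $ i))\<^sup>2)"

definition braket :: "complex vec \<Rightarrow> complex vec \<Rightarrow> complex" where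
  "braket u w = (\<Sum>i<dim_vec u. cnj (u $ i) * w $ i)"

text \<open>Coordinate 0 is |0hat>; coordinate 1 + (i*m + k)*2 + b is |i>|k>|b>
  (i<n, k<m, b\<in>{0,1}, with True = 1).  Hvec n m a w = a|0hat> + sum_{i,k,b} w i k b |i>|k>|b>.\<close>
definition Hvec :: "nat \<Rightarrow> nat \<Rightarrow> complex \<Rightarrow> (nat \<Rightarrow> nat \<Rightarrow> bool \<Rightarrow> complex) \<Rightarrow> complex vec" where
  "Hvec n m a w = vec (1 + n * m * 2)
     (\<lambda>t. if t = 0 then a else w ((t - 1) div 2 div m) ((t - 1) div 2 mod m) (odd (t - 1)))"

definition cconst :: real where "cconst = 100"

definition size_A :: "nat \<Rightarrow> bool list set \<Rightarrow> (bool list \<Rightarrow> nat \<Rightarrow> complex vec) \<Rightarrow> real" where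
  "size_A n X v = Max ((\<lambda>x. \<Sum>j<n. vnorm2 (v x j)) ` X)"

definition nu :: "nat \<Rightarrow> real \<Rightarrow> (bool list \<Rightarrow> nat \<Rightarrow> complex vec) \<Rightarrow> bool list \<Rightarrow> real" where
  "nu n A v x = 1 + (1 / (cconst * A)) * (\<Sum>i<n. vnorm2 (v x i))"

definition mu :: "nat \<Rightarrow> real \<Rightarrow> (bool list \<Rightarrow> nat \<Rightarrow> complex vec) \<Rightarrow> bool list \<Rightarrow> real" where
  "mu n A v x = 1 + (cconst * A) * (\<Sum>i<n. vnorm2 (v x i))"

definition psi :: "nat \<Rightarrow> nat \<Rightarrow> real \<Rightarrow> (bool list \<Rightarrow> nat \<Rightarrow> complex vec) \<Rightarrow> bool list \<Rightarrow> complex vec" where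
  "psi n m A v x = complex_of_real (1 / sqrt (nu n A v x)) \<cdot>\<^sub>v
     Hvec n m 1 (\<lambda>i k b. if b = x ! i
        then complex_of_real (1 / sqrt (cconst * A)) * (v x i $ k) else 0)"

definition phi :: "nat \<Rightarrow> nat \<Rightarrow> real \<Rightarrow> (bool list \<Rightarrow> nat \<Rightarrow> complex vec) \<Rightarrow> bool list \<Rightarrow> complex vec" where
  "phi n m A v y = complex_of_real (1 / sqrt (mu n A v y)) \<cdot>\<^sub>v
     Hvec n m 1 (\<lambda>i k b. if b = (\<not> y ! i)
        then - complex_of_real (sqrt (cconst * A)) * (v y i $ k) else 0)"

text \<open>epsilon = max |<psi_x|phi_y>| over f x = 1, f y = 0 (taken to be 0 if one side is empty)\<close>
definition eps_val :: "nat \<Rightarrow> nat \<Rightarrow> real \<Rightarrow> bool list set \<Rightarrow> (bool list \<Rightarrow> bool)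
     \<Rightarrow> (bool list \<Rightarrow> nat \<Rightarrow> complex vec) \<Rightarrow> real" where
  "eps_val n m A X f v = Max (insert 0
     {cmod (braket (psi n m A v x) (phi n m A v y)) | x y. x \<in> X \<and> y \<in> X \<and> f x \<and> \<not> f y})"

definition Mmat :: "nat \<Rightarrow> nat \<Rightarrow> real \<Rightarrow> bool list set \<Rightarrow> (bool list \<Rightarrow> bool)
     \<Rightarrow> (bool list \<Rightarrow> nat \<Rightarrow> complex vec) \<Rightarrow> complex mat" where
  "Mmat n m A X f v = (let ones = sorted_list_of_set {x \<in> X. f x} in
     mat (length ones) (1 + n * m * 2) (\<lambda>(r,t). cnj (psi n m A v (ones ! r) $ t)))"

text \<open>s is the full list of singular values of M (sqrt of the eigenvalues of M M^*, with
  multiplicity), in non-increasing order.\<close>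
definition singular_values :: "complex mat \<Rightarrow> real list \<Rightarrow> bool" where
  "singular_values M s \<longleftrightarrow> length s = dim_row M \<and> sorted_wrt (\<ge>) s \<and> (\<forall>\<sigma>\<in>set s. \<sigma> \<ge> 0) \<and>
     char_poly (M * adj M) = (\<Prod>\<sigma>\<leftarrow>s. [: - complex_of_real (\<sigma>\<^sup>2), 1 :])"

text \<open>number of nonzero singular values (= rank M)\<close>
definition kappa :: "real list \<Rightarrow> nat" where
  "kappa s = length (filter (\<lambda>\<sigma>. \<sigma> > 0) s)"

definition sval :: "real list \<Rightarrow> nat \<Rightarrow> real" where
  "sval s k = (if 1 \<le> k \<and> k \<le> length s then s ! (k - 1) else 0)"

text \<open>Space C^n (x) C^2 (x) C^W (query index, query bit, workspace), dimension S = n*2*W;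
  basis |i,b,w> has index (i*2+b)*W + w.\<close>
definition qdim :: "nat \<Rightarrow> nat \<Rightarrow> nat" where "qdim n W = n * 2 * W"

definition query_op :: "nat \<Rightarrow> nat \<Rightarrow> bool list \<Rightarrow> complex mat" where
  "query_op n W x = mat (qdim n W) (qdim n W) (\<lambda>(r,c).
     (let w = c mod W; i = c div W div 2; b = odd (c div W)
      in if r = (i * 2 + (if b \<noteq> x ! i then 1 else 0)) * W + w then 1 else 0))"

definition run_alg :: "nat \<Rightarrow> nat \<Rightarrow> complex mat list \<Rightarrow> bool list \<Rightarrow> complex vec" where
  "run_alg n W Us x = foldl (\<lambda>st U. U *\<^sub>v (query_op n W x *\<^sub>v st))
      (hd Us *\<^sub>v unit_vec (qdim n W) 0) (tl Us)"

text \<open>A T-query algorithm with measurement {P, I-P} (outcome 1 = P) computing f on X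
  with success probability at least 2/3; it uses log2 S qubits.\<close>
definition computes :: "nat \<Rightarrow> bool list set \<Rightarrow> (bool list \<Rightarrow> bool) \<Rightarrow> nat \<Rightarrow> nat
    \<Rightarrow> complex mat list \<Rightarrow> complex mat \<Rightarrow> bool" where
  "computes n X f W T Us P \<longleftrightarrow> W \<ge> 1 \<and> length Us = T + 1 \<and>
     (\<forall>U\<in>set Us. unitary_mat (qdim n W) U) \<and> projector (qdim n W) P \<and>
     (\<forall>x\<in>X. (f x \<longrightarrow> vnorm2 (P *\<^sub>v run_alg n W Us x) \<ge> 2/3) \<and>
             (\<not> f x \<longrightarrow> vnorm2 ((1\<^sub>m (qdim n W) - P) *\<^sub>v run_alg n W Us x) \<ge> 2/3))"

end

theory Submission
  imports Defs "HOL-Analysis.L2_Norm"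
begin

text \<open>
  Let \<open>D\<close> project onto the span of the \<open>k\<close> leading right singular vectors of \<open>M\<close>, let
  \<open>\<Pi>\<^sub>x\<close> project onto \<open>|0hat>\<close> and the \<open>|i>|v>|x\<^sub>i>\<close>, and put
  \<open>U = (2 D - 1) (2 \<Pi>\<^sub>x - 1)\<close>, which costs two queries. The hypotheses on the singular values say that
  \<open>\<psi>\<^sub>x\<close> is almost fixed by \<open>D\<close> and that \<open>\<phi>\<^sub>x\<close> is almost annihilated by it. Hence if
  \<open>f x\<close> then \<open>U\<close> almost fixes \<open>\<psi>\<^sub>x\<close>, which is close to \<open>|0hat>\<close>; and if \<open>f x\<close> fails then
  \<open>|0hat>\<close> is, up to an error of norm about \<open>1/2\<close>, a coboundary \<open>w - U w\<close> with \<open>w\<close> of norm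
  \<open>O(A)\<close>. The two cases are told apart without phase estimation, whose register would need
  \<open>log A\<close> qubits: a single control qubit is rotated by a small angle \<open>d = \<Theta>(1/A)\<close> between
  controlled applications of \<open>U\<close>. On a fixed vector of \<open>U\<close> the rotations add up, so after
  \<open>\<pi> / (2 d)\<close> steps the qubit has flipped; on a coboundary they stay out of phase, and the
  amplitude of the flipped qubit is at most \<open>2 tan d\<close> times the norm of \<open>w\<close>.\<close>

section \<open>Adjoints, brackets and norms\<close>

lemma adj_carrier [simp]: "A \<in> carrier_mat a b \<Longrightarrow> adj A \<in> carrier_mat b a"
  by (auto simp: adj_def)

lemma dim_adj [simp]: "dim_row (adj A) = dim_col A" "dim_col (adj A) = dim_row A"
  by (auto simp: adj_def)

lemma index_adj [simp]:
  "i < dim_col A \<Longrightarrow> j < dim_row A \<Longrightarrow> adj A $$ (i, j) = cnj (A $$ (j, i))"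
  by (auto simp: adj_def)

lemma adj_adj [simp]: "adj (adj A) = A"
  by (intro eq_matI) auto

lemma adj_one [simp]: "adj (1\<^sub>m k) = 1\<^sub>m k"
  by (intro eq_matI) auto

lemma adj_mult: "A \<in> carrier_mat a b \<Longrightarrow> B \<in> carrier_mat b c \<Longrightarrow> adj (A * B) = adj B * adj A"
  by (intro eq_matI) (auto simp: scalar_prod_def mult.commute intro!: sum.cong)

lemma adj_smult: "adj (c \<cdot>\<^sub>m A) = cnj c \<cdot>\<^sub>m adj A"
  by (intro eq_matI) auto

lemma braket_mult_mat_vec:
  assumes "A \<in> carrier_mat a b" "u \<in> carrier_vec a" "w \<in> carrier_vec b"
  shows "braket u (A *\<^sub>v w) = braket (adj A *\<^sub>v u) w"
proof -
  have "braket u (A *\<^sub>v w) = (\<Sum>i<a. \<Sum>j<b. cnj (u $ i) * A $$ (i, j) * w $ j)"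
    using assms by (auto simp: braket_def scalar_prod_def sum_distrib_left mult.assoc
        lessThan_atLeast0 intro!: sum.cong)
  also have "\<dots> = (\<Sum>j<b. \<Sum>i<a. cnj (u $ i) * A $$ (i, j) * w $ j)"
    by (rule sum.swap)
  also have "\<dots> = braket (adj A *\<^sub>v u) w"
    using assms by (auto simp: braket_def scalar_prod_def sum_distrib_right sum_distrib_left
        mult_ac lessThan_atLeast0 intro!: sum.cong)
  finally show ?thesis .
qed

lemma of_real_vnorm2: "complex_of_real (vnorm2 u) = braket u u"
  unfolding vnorm2_def braket_def of_real_sum
  by (intro sum.cong refl) (metis complex_norm_square mult.commute)

lemma vnorm2_nonneg [simp]: "0 \<le> vnorm2 u"
  by (simp add: vnorm2_def sum_nonneg)

lemma vnorm2_zero [simp]: "vnorm2 (0\<^sub>v k) = 0"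
  by (simp add: vnorm2_def)

lemma vnorm2_smult: "vnorm2 (c \<cdot>\<^sub>v u) = (cmod c)\<^sup>2 * vnorm2 u"
  by (simp add: vnorm2_def norm_mult power_mult_distrib sum_distrib_left)

lemma vnorm2_eq_0_iff: "vnorm2 u = 0 \<longleftrightarrow> u = 0\<^sub>v (dim_vec u)"
proof -
  have "vnorm2 u = 0 \<longleftrightarrow> (\<forall>i<dim_vec u. u $ i = 0)"
    by (auto simp: vnorm2_def sum_nonneg_eq_0_iff)
  also have "\<dots> \<longleftrightarrow> u = 0\<^sub>v (dim_vec u)"
    by (simp add: vec_eq_iff)
  finally show ?thesis .
qed

lemma vnorm2_unit_vec [simp]: "i < k \<Longrightarrow> vnorm2 (unit_vec k i) = 1"
  by (simp add: vnorm2_def unit_vec_def if_distrib [of "\<lambda>x. (cmod x)\<^sup>2"] cong: if_cong)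

lemma vnorm2_isometry:
  assumes "U \<in> carrier_mat a b" "adj U * U = 1\<^sub>m b" "u \<in> carrier_vec b"
  shows "vnorm2 (U *\<^sub>v u) = vnorm2 u"
proof -
  have "braket (U *\<^sub>v u) (U *\<^sub>v u) = braket (adj U *\<^sub>v (U *\<^sub>v u)) u"
    using assms by (intro braket_mult_mat_vec) auto
  also have "adj U *\<^sub>v (U *\<^sub>v u) = u"
    using assms by (simp flip: assoc_mult_mat_vec [of _ b a _ b])
  finally show ?thesis
    by (simp flip: of_real_vnorm2)
qed

section \<open>The Euclidean norm\<close>

definition vnorm :: "complex vec \<Rightarrow> real" where
  "vnorm u = sqrt (vnorm2 u)"

lemma vnorm_nonneg [simp]: "0 \<le> vnorm u"
  by (simp add: vnorm_def)

lemma vnorm_power2: "(vnorm u)\<^sup>2 = vnorm2 u"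
  by (simp add: vnorm_def)

lemma vnorm_zero [simp]: "vnorm (0\<^sub>v k) = 0"
  by (simp add: vnorm_def)

lemma vnorm_smult: "vnorm (c \<cdot>\<^sub>v u) = cmod c * vnorm u"
  by (simp add: vnorm_def vnorm2_smult real_sqrt_mult)

lemma vnorm_triangle:
  assumes "u \<in> carrier_vec k" "w \<in> carrier_vec k"
  shows "vnorm (u + w) \<le> vnorm u + vnorm w"
proof -
  have *: "vnorm z = L2_set (\<lambda>i. cmod (z $ i)) {..<k}" if "z \<in> carrier_vec k" for z
    using that by (auto simp: vnorm_def vnorm2_def L2_set_def)
  have "vnorm (u + w) \<le> L2_set (\<lambda>i. cmod (u $ i) + cmod (w $ i)) {..<k}"
    using assms by (auto simp: * intro!: L2_set_mono norm_triangle_ineq)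
  also have "\<dots> \<le> vnorm u + vnorm w"
    using assms by (simp add: * L2_set_triangle_ineq)
  finally show ?thesis .
qed

lemma vnorm_uminus [simp]: "vnorm (- u) = vnorm u"
  by (simp add: vnorm_def vnorm2_def)

lemma vnorm_minus_le:
  assumes "u \<in> carrier_vec k" "w \<in> carrier_vec k"
  shows "vnorm (u - w) \<le> vnorm u + vnorm w"
  using vnorm_triangle [of u k "- w"] assms by (simp add: minus_add_uminus_vec)

section \<open>Unitary matrices\<close>

lemma unitary_mat_carrier: "unitary_mat k U \<Longrightarrow> U \<in> carrier_mat k k"
  by (simp add: unitary_mat_def)

lemma unitary_mat_right: "unitary_mat k U \<Longrightarrow> U * adj U = 1\<^sub>m k"
  unfolding unitary_mat_def by (metis adj_carrier mat_mult_left_right_inverse)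

lemma unitary_mat_adj: "unitary_mat k U \<Longrightarrow> unitary_mat k (adj U)"
  using unitary_mat_right by (auto simp: unitary_mat_def)

lemma unitary_mat_one [simp]: "unitary_mat k (1\<^sub>m k)"
  by (simp add: unitary_mat_def)

lemma unitary_mat_mult:
  assumes "unitary_mat k U" "unitary_mat k V"
  shows "unitary_mat k (U * V)"
proof -
  have c: "U \<in> carrier_mat k k" "V \<in> carrier_mat k k"
    using assms by (auto simp: unitary_mat_def)
  have "adj (U * V) * (U * V) = adj V * (adj U * U) * V"
    using c adj_carrier [OF c(1)] adj_carrier [OF c(2)]
    by (smt (verit) adj_mult assoc_mult_mat mult_carrier_mat)
  also have "\<dots> = 1\<^sub>m k"
    using assms by (simp add: unitary_mat_def right_mult_one_mat [OF adj_carrier [OF c(2)]])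
  finally show ?thesis
    using c by (simp add: unitary_mat_def)
qed

lemma unitary_mat_pow: "unitary_mat k U \<Longrightarrow> unitary_mat k (U ^\<^sub>m j)"
  by (induction j) (auto simp: unitary_mat_mult dest: unitary_mat_carrier)

lemma vnorm_unitary:
  "unitary_mat k U \<Longrightarrow> u \<in> carrier_vec k \<Longrightarrow> vnorm (U *\<^sub>v u) = vnorm u"
  by (simp add: vnorm_def unitary_mat_def vnorm2_isometry [of U k k])

section \<open>Unitary diagonalization of Hermitian matrices\<close>

text \<open>The witness is the Householder reflection along \<open>u - e\<^sub>0\<close>.\<close>

lemma householder_real:
  assumes u: "u \<in> carrier_vec k" "vnorm2 u = 1" "0 < k" and re: "u $ 0 = complex_of_real r"
  shows "\<exists>W. unitary_mat k W \<and> col W 0 = u"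
\<comment> \<open>For \<open>r = 1\<close> the vector \<open>u - unit_vec k 0\<close> vanishes and
  there is nothing to reflect along; then \<open>u\<close> is the first basis vector and the
  identity serves.\<close>
proof (cases "r = 1")
  case True
  have "(\<Sum>i<k. (cmod (u $ i))\<^sup>2) = 1"
    using u by (simp add: vnorm2_def)
  then have "(cmod (u $ 0))\<^sup>2 + (\<Sum>i\<in>{..<k} - {0}. (cmod (u $ i))\<^sup>2) = 1"
    using u by (subst (asm) sum.remove [of _ 0]) auto
  then have "(\<Sum>i\<in>{..<k} - {0}. (cmod (u $ i))\<^sup>2) = 0"
    using re True by simp
  then have "\<forall>i\<in>{..<k} - {0}. u $ i = 0"
    by (simp add: sum_nonneg_eq_0_iff)
  then have "col (1\<^sub>m k) 0 = u"
    using u re True by (intro eq_vecI) auto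
  then show ?thesis
    by (intro exI [of _ "1\<^sub>m k"]) auto
next
  case False
  define v where "v = u - unit_vec k 0"
  \<comment> \<open>\<open>d\<close> is the squared norm of \<open>v\<close>. Because
    \<open>u $ 0\<close> is real, \<open>v\<close> has first entry \<open>r - 1 = - d / 2\<close>,
    so the reflection carries the first basis vector to \<open>u\<close>.\<close>
  define d where "d = 2 - 2 * complex_of_real r"
  have d: "d \<noteq> 0"
    using False by (simp add: d_def complex_eq_iff)
  define W where "W = mat k k (\<lambda>(i, j). (if i = j then 1 else 0) - 2 / d * (v $ i * cnj (v $ j)))"
  have W: "W \<in> carrier_mat k k"
    by (simp add: W_def)
  have cd: "cnj d = d"
    by (simp add: d_def)
  have adjW: "adj W = W"
    by (intro eq_matI) (auto simp: W_def cd mult.commute)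
  have vi: "v $ i = u $ i - (if i = 0 then 1 else 0)" if "i < k" for i
    using that u by (simp add: v_def)
  have su: "(\<Sum>i<k. cnj (u $ i) * u $ i) = 1"
    using of_real_vnorm2 [of u] u by (simp add: braket_def)
  have sv: "(\<Sum>i<k. cnj (v $ i) * v $ i) = d"
  proof -
    have "(\<Sum>i<k. cnj (v $ i) * v $ i) = (\<Sum>i<k. cnj (u $ i) * u $ i
        + (if i = 0 then 1 - 2 * complex_of_real r else 0))"
      using re by (intro sum.cong) (auto simp: vi algebra_simps)
    also have "\<dots> = d"
      using u by (simp add: sum.distrib su d_def)
    finally show ?thesis .
  qed
  have "W * W = 1\<^sub>m k"
  proof (intro eq_matI)
    fix i j assume "i < dim_row (1\<^sub>m k)" "j < dim_col (1\<^sub>m k)"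
    then have ij: "i < k" "j < k" by auto
    have "(W * W) $$ (i, j) = (\<Sum>l<k. ((if i = l then 1 else 0) - 2 / d * (v $ i * cnj (v $ l))) *
        ((if l = j then 1 else 0) - 2 / d * (v $ l * cnj (v $ j))))"
      using ij by (simp add: W_def scalar_prod_def lessThan_atLeast0)
    also have "\<dots> = (\<Sum>l<k. (if l = i then (if i = j then 1 else 0) - 2 / d * (v $ i * cnj (v $ j)) else 0)
        - (if l = j then 2 / d * (v $ i * cnj (v $ j)) else 0)
        + (2 / d)\<^sup>2 * (v $ i * cnj (v $ j)) * (cnj (v $ l) * v $ l))"
      by (intro sum.cong) (auto simp: algebra_simps power2_eq_square)
    also have "\<dots> = (if i = j then 1 else 0) - 4 / d * (v $ i * cnj (v $ j))
        + (2 / d)\<^sup>2 * (v $ i * cnj (v $ j)) * d"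
      using ij by (simp add: sum.distrib sum_subtractf sv flip: sum_distrib_left)
    also have "\<dots> = (1\<^sub>m k) $$ (i, j)"
      using ij d by (simp add: power2_eq_square field_simps)
    finally show "(W * W) $$ (i, j) = (1\<^sub>m k) $$ (i, j)" .
  qed (use W in auto)
  moreover have "col W 0 = u"
  proof (intro eq_vecI)
    fix i assume "i < dim_vec u"
    then have "i < k" using u by simp
    then show "col W 0 $ i = u $ i"
      using u re d by (auto simp: W_def vi field_simps) (auto simp: d_def algebra_simps)
  qed (use u W in auto)
  ultimately show ?thesis
    using W adjW by (intro exI [of _ W]) (auto simp: unitary_mat_def)
qed

lemma ex_phase: "\<exists>c r. cmod c = 1 \<and> c * z = complex_of_real r"
proof (intro exI conjI)
  show "cis (- Arg z) * z = complex_of_real (cmod z)"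
    by (subst (2) rcis_cmod_Arg [of z, symmetric]) (simp add: rcis_def cis_mult)
qed simp

text \<open>Dividing by the norm and turning the phase of the first entry brings \<open>u\<close>
  into the form that the Householder reflection handles; \<open>c\<close> absorbs both
  factors.\<close>

lemma unitary_with_first_col:
  assumes u: "u \<in> carrier_vec k" "u \<noteq> 0\<^sub>v k"
  shows "\<exists>W c. unitary_mat k W \<and> col W 0 = c \<cdot>\<^sub>v u"
proof -
  have "vnorm2 u \<noteq> 0"
    using u by (auto simp: vnorm2_eq_0_iff)
  then have n: "vnorm u \<noteq> 0" "vnorm2 u \<noteq> 0"
    by (simp_all add: vnorm_def)
  have k: "0 < k"
    using u by (cases k) auto
  obtain c r where c: "cmod c = 1" "c * u $ 0 = complex_of_real r"
    using ex_phase by blast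
  define b where "b = c / complex_of_real (vnorm u)"
  have "\<exists>W. unitary_mat k W \<and> col W 0 = b \<cdot>\<^sub>v u"
  proof (rule householder_real)
    have "(cmod b)\<^sup>2 * vnorm2 u = 1"
      using n c by (simp add: b_def norm_divide power_divide vnorm_power2)
    then show "vnorm2 (b \<cdot>\<^sub>v u) = 1"
      by (simp add: vnorm2_smult)
    show "(b \<cdot>\<^sub>v u) $ 0 = complex_of_real (r / vnorm u)"
      using u k c by (simp add: b_def)
  qed (use u k in auto)
  then show ?thesis by blast
qed

definition diag :: "nat \<Rightarrow> (nat \<Rightarrow> complex) \<Rightarrow> complex mat" where
  "diag k d = mat k k (\<lambda>(i, j). if i = j then d i else 0)"

text \<open>An eigenvector as first column of \<open>W\<close> makes the first column of
  \<open>adj W * G * W\<close> a multiple of a basis vector, and Hermitian symmetry then clears the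
  first row. Cancelling the linear factor of the characteristic polynomial leaves that of the
  smaller block.\<close>

lemma hermitian_deflation:
  assumes G: "G \<in> carrier_mat (Suc r) (Suc r)" and hG: "adj G = G"
    and cp: "char_poly G = [:- e, 1:] * p"
  shows "\<exists>W G'. unitary_mat (Suc r) W \<and> G' \<in> carrier_mat r r \<and> adj G' = G' \<and> char_poly G' = p
    \<and> adj W * G * W = four_block_mat (mat 1 1 (\<lambda>_. e)) (0\<^sub>m 1 r) (0\<^sub>m r 1) G'"
proof -
  have "poly (char_poly G) e = 0"
    by (simp add: cp)
  then obtain u where u: "eigenvector G u e"
    using eigenvalue_root_char_poly [OF G] by (auto simp: eigenvalue_def)
  then have uc: "u \<in> carrier_vec (Suc r)" "u \<noteq> 0\<^sub>v (Suc r)" "G *\<^sub>v u = e \<cdot>\<^sub>v u"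
    using G by (auto simp: eigenvector_def)
  obtain W c where W: "unitary_mat (Suc r) W" and colW: "col W 0 = c \<cdot>\<^sub>v u"
    using unitary_with_first_col [OF uc(1,2)] by blast
  have Wc: "W \<in> carrier_mat (Suc r) (Suc r)" "adj W \<in> carrier_mat (Suc r) (Suc r)"
    using W by (auto simp: unitary_mat_def)
  define H where "H = adj W * G * W"
  have Hc: "H \<in> carrier_mat (Suc r) (Suc r)"
    using G Wc by (simp add: H_def mult_carrier_mat [of _ "Suc r" "Suc r"])
  have adjH: "adj H = H"
    using G Wc hG
    by (simp add: H_def adj_mult [of _ "Suc r" "Suc r" _ "Suc r"]
        mult_carrier_mat [of _ "Suc r" "Suc r"] assoc_mult_mat [of _ "Suc r" "Suc r" _ "Suc r" _ "Suc r"])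
  have "col W 0 \<in> carrier_vec (Suc r)"
    using Wc(1) by (intro carrier_vecI) simp
  then have "col H 0 = adj W *\<^sub>v (G *\<^sub>v col W 0)"
    unfolding H_def using G Wc
    by (simp add: col_mult2 [of _ "Suc r" "Suc r" _ "Suc r"] mult_carrier_mat [of _ "Suc r" "Suc r"]
        assoc_mult_mat_vec [of _ "Suc r" "Suc r" _ "Suc r"])
  also have "\<dots> = e \<cdot>\<^sub>v (adj W *\<^sub>v col W 0)"
    using G Wc uc by (simp add: colW mult_mat_vec [of _ "Suc r" "Suc r"] smult_smult_assoc mult.commute)
  also have "adj W *\<^sub>v col W 0 = col (1\<^sub>m (Suc r)) 0"
    using W Wc by (simp add: unitary_mat_def flip: col_mult2 [of _ "Suc r" "Suc r" _ "Suc r"])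
  finally have colH: "H $$ (i, 0) = (if i = 0 then e else 0)" if "i < Suc r" for i
    using Hc that by (auto simp: vec_eq_iff)
  have rowH: "H $$ (0, j) = (if j = 0 then e else 0)" if "j < Suc r" for j
  proof -
    have "H $$ (0, j) = adj H $$ (0, j)" by (simp add: adjH)
    also have "\<dots> = cnj (H $$ (j, 0))" using Hc that by simp
    also have "\<dots> = (if j = 0 then e else 0)"
    proof (cases "j = 0")
      case True
      \<comment> \<open>A diagonal entry of a Hermitian matrix is its own conjugate, so
        \<open>e\<close> is real.\<close>
      have "cnj (H $$ (0, 0)) = adj H $$ (0, 0)" using Hc by simp
      then show ?thesis using True colH by (simp add: adjH)
    qed (use colH that in auto)
    finally show ?thesis .
  qed
  define G' where "G' = mat r r (\<lambda>(i, j). H $$ (Suc i, Suc j))"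
  have G'c: "G' \<in> carrier_mat r r"
    by (simp add: G'_def)
  have H: "H = four_block_mat (mat 1 1 (\<lambda>_. e)) (0\<^sub>m 1 r) (0\<^sub>m r 1) G'"
    using Hc by (intro eq_matI) (auto simp: G'_def colH rowH)
  have "similar_mat_wit H G (adj W) W"
    using W Wc G Hc unitary_mat_right [OF W]
    by (auto simp: similar_mat_wit_def Let_def unitary_mat_def H_def)
  then have "char_poly H = char_poly G"
    by (intro char_poly_similar) (auto simp: similar_mat_def)
  moreover have "char_poly H = char_poly (mat 1 1 (\<lambda>_. e)) * char_poly G'"
    unfolding H by (rule char_poly_four_block_zeros_col) (auto simp: G'c)
  moreover have "char_poly (mat 1 1 (\<lambda>_. e)) = [:- e, 1:]"
    by (subst char_poly_upper_triangular [of _ 1]) (auto simp: diag_mat_def)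
  ultimately have "[:- e, 1:] * char_poly G' = [:- e, 1:] * p"
    using cp by simp
  then have cp': "char_poly G' = p"
    by (subst (asm) mult_cancel_left) simp
  have adjG': "adj G' = G'"
  proof (intro eq_matI)
    fix i j assume "i < dim_row G'" "j < dim_col G'"
    then show "adj G' $$ (i, j) = G' $$ (i, j)"
      using arg_cong [OF adjH, of "\<lambda>A. A $$ (Suc i, Suc j)"] Hc by (auto simp: G'_def)
  qed (use G'c in auto)
  show ?thesis
    using W G'c adjG' cp' H [unfolded H_def] by blast
qed

text \<open>The basis is \<open>W\<close> times the block sum of the 1-by-1 identity and
  \<open>Q'\<close>.\<close>

lemma hermitian_diagonalization_step:
  assumes G: "G \<in> carrier_mat (Suc r) (Suc r)" and W: "unitary_mat (Suc r) W"
    and G'c: "G' \<in> carrier_mat r r"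
    and H: "adj W * G * W = four_block_mat (mat 1 1 (\<lambda>_. e)) (0\<^sub>m 1 r) (0\<^sub>m r 1) G'"
    and Q': "unitary_mat r Q'" and dQ: "adj Q' * G' * Q' = diag r ((!) es)"
  shows "\<exists>Q. unitary_mat (Suc r) Q \<and> adj Q * G * Q = diag (Suc r) ((!) (e # es))"
proof -
  have Wc: "W \<in> carrier_mat (Suc r) (Suc r)" "adj W \<in> carrier_mat (Suc r) (Suc r)"
    using W by (auto simp: unitary_mat_def)
  have Q'c: "Q' \<in> carrier_mat r r"
    using Q' by (simp add: unitary_mat_def)
  define Q1 where "Q1 = four_block_mat (1\<^sub>m 1) (0\<^sub>m 1 r) (0\<^sub>m r 1) Q'"
  have Q1c: "Q1 \<in> carrier_mat (Suc r) (Suc r)"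
    using four_block_carrier_mat [of "1\<^sub>m 1" 1 1 Q' r r] Q'c by (simp add: Q1_def)
  have adjQ1: "adj Q1 = four_block_mat (1\<^sub>m 1) (0\<^sub>m 1 r) (0\<^sub>m r 1) (adj Q')"
    using Q'c by (intro eq_matI) (auto simp: Q1_def)
  have block: "four_block_mat A (0\<^sub>m 1 r) (0\<^sub>m r 1) D * four_block_mat A' (0\<^sub>m 1 r) (0\<^sub>m r 1) D'
      = four_block_mat (A * A') (0\<^sub>m 1 r) (0\<^sub>m r 1) (D * D')"
    if "A \<in> carrier_mat 1 1" "A' \<in> carrier_mat 1 1" "D \<in> carrier_mat r r" "D' \<in> carrier_mat r r"
    for A A' D D' :: "complex mat"
    using that by (subst mult_four_block_mat [of _ 1 1 _ r _ r _ _ 1 _ r]) auto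
  have Q1: "unitary_mat (Suc r) Q1"
    using Q1c Q' Q'c unfolding unitary_mat_def adjQ1 unfolding Q1_def
    by (subst block) (auto intro!: eq_matI)
  have "adj (W * Q1) * G * (W * Q1) = adj Q1 * (adj W * G * W) * Q1"
    using G Wc Q1c
    by (simp add: adj_mult [of _ "Suc r" "Suc r" _ "Suc r"]
        mult_carrier_mat [of _ "Suc r" "Suc r"] assoc_mult_mat [of _ "Suc r" "Suc r" _ "Suc r" _ "Suc r"])
  also have "\<dots> = four_block_mat (mat 1 1 (\<lambda>_. e)) (0\<^sub>m 1 r) (0\<^sub>m r 1) (adj Q' * G' * Q')"
    unfolding adjQ1 H unfolding Q1_def using Q'c G'c adj_carrier [OF Q'c]
    by (simp add: block mult_carrier_mat [of _ r r] del: One_nat_def)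
  also have "\<dots> = diag (Suc r) ((!) (e # es))"
    unfolding dQ
  proof (intro eq_matI, goal_cases)
    case (1 i j)
    then show ?case
      by (cases i; cases j) (auto simp: diag_def)
  qed (auto simp: diag_def)
  finally show ?thesis
    using unitary_mat_mult [OF W Q1] by blast
qed

text \<open>The factorization is given, and deflation removes its factors one by one from the left,
  so the eigenvalues appear on the diagonal in the order of \<open>es\<close>. For singular values
  an index is therefore a rank in the sorted list.\<close>

lemma hermitian_diagonalization:
  assumes "G \<in> carrier_mat r r" "adj G = G" "char_poly G = (\<Prod>e\<leftarrow>es. [:- e, 1:])"
  shows "\<exists>Q. unitary_mat r Q \<and> adj Q * G * Q = diag r ((!) es)"
  using assms
proof (induction r arbitrary: G es)
  case 0
  then show ?case
    by (intro exI [of _ "1\<^sub>m 0"]) (auto simp: diag_def)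
next
  case (Suc r)
  \<comment> \<open>Comparing degrees shows that the list is nonempty and as long as the matrix is
    wide.\<close>
  have "degree (char_poly G) = length es"
    using Suc.prems(3) degree_linear_factors [of uminus es] by simp
  then have "length es = Suc r"
    using degree_monic_char_poly [OF Suc.prems(1)] by simp
  then obtain e es' where es: "es = e # es'"
    by (cases es) auto
  have "char_poly G = [:- e, 1:] * (\<Prod>e\<leftarrow>es'. [:- e, 1:])"
    using Suc.prems(3) by (simp add: es)
  from hermitian_deflation [OF Suc.prems(1,2) this]
  obtain W G' where W: "unitary_mat (Suc r) W" and G': "G' \<in> carrier_mat r r" "adj G' = G'"
    "char_poly G' = (\<Prod>e\<leftarrow>es'. [:- e, 1:])"
    and H: "adj W * G * W = four_block_mat (mat 1 1 (\<lambda>_. e)) (0\<^sub>m 1 r) (0\<^sub>m r 1) G'"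
    by blast
  obtain Q' where Q': "unitary_mat r Q'" "adj Q' * G' * Q' = diag r ((!) es')"
    using Suc.IH [OF G'] by blast
  show ?case
    unfolding es by (rule hermitian_diagonalization_step [OF Suc.prems(1) W G'(1) H Q'])
qed

section \<open>The projection onto the leading right singular vectors\<close>

lemma diag_carrier [simp]: "diag k d \<in> carrier_mat k k"
  by (simp add: diag_def)

lemma diag_mult: "diag k d * diag k d' = diag k (\<lambda>i. d i * d' i)"
  by (intro eq_matI)
    (auto simp: diag_def scalar_prod_def if_distrib [of "\<lambda>x. x * _"] sum.delta' cong: if_cong)

lemma adj_diag: "adj (diag k d) = diag k (\<lambda>i. cnj (d i))"
  by (intro eq_matI) (auto simp: diag_def)

lemma diag_mult_vec: "u \<in> carrier_vec k \<Longrightarrow> diag k d *\<^sub>v u = vec k (\<lambda>i. d i * u $ i)"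
  by (intro eq_vecI)
    (auto simp: diag_def scalar_prod_def if_distrib [of "\<lambda>x. x * _"] sum.delta' cong: if_cong)

lemma diag_cong: "(\<And>i. i < k \<Longrightarrow> d i = d' i) \<Longrightarrow> diag k d = diag k d'"
  by (intro eq_matI) (auto simp: diag_def)

lemma braket_diag:
  "u \<in> carrier_vec k \<Longrightarrow> braket u (diag k d *\<^sub>v u) = (\<Sum>i<k. d i * complex_of_real ((cmod (u $ i))\<^sup>2))"
  by (auto simp: diag_mult_vec braket_def complex_norm_square mult_ac simp del: of_real_power
      intro!: sum.cong)

lemma mult_unit_vec: "(A :: complex mat) \<in> carrier_mat a b \<Longrightarrow> i < b \<Longrightarrow> A *\<^sub>v unit_vec b i = col A i"
  by (intro eq_vecI) (auto simp: scalar_prod_def unit_vec_def if_distrib [of "\<lambda>x. _ * x"] cong: if_cong)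

lemma singular_values_antimono:
  assumes "singular_values M s" "i \<le> j" "j < length s"
  shows "s ! j \<le> s ! i"
  using assms sorted_wrt_nth_less [of "(\<ge>)" s i j] by (cases "i = j") (auto simp: singular_values_def)

text \<open>The list is non-increasing, so its positive entries form a prefix, of length
  \<open>kappa s\<close>.\<close>

lemma kappa_pos:
  assumes "singular_values M s" "j < kappa s"
  shows "j < length s" "0 < s ! j"
proof -
  show len: "j < length s"
    using assms(2) unfolding kappa_def by (rule less_le_trans) (rule length_filter_le)
  show "0 < s ! j"
  proof (rule ccontr)
    assume *: "\<not> 0 < s ! j"
    have "{i. i < length s \<and> 0 < s ! i} \<subseteq> {..<j}"
      using singular_values_antimono [OF assms(1)] * by (force simp: not_less [symmetric])
    then have "kappa s \<le> j"
      using card_mono [of "{..<j}"] by (simp add: kappa_def length_filter_conv_card)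
    then show False using assms by simp
  qed
qed

text \<open>If \<open>Q\<close> diagonalizes \<open>M * adj M\<close>, the columns of
  \<open>Y = adj M * Q\<close> are orthogonal with squared norms \<open>(s ! i)\<^sup>2\<close>:
  they are the right singular vectors before normalization, and \<open>D\<close> projects onto the
  first \<open>k\<close>. The first bound holds because \<open>M u\<close> has the coordinates
  \<open>adj Y u\<close> in the basis \<open>Q\<close>, the second because a conjugated row of
  \<open>M\<close> is \<open>Y\<close> applied to a unit vector.\<close>

lemma truncated_svd_projector:
  assumes M: "M \<in> carrier_mat r N" and s: "singular_values M s" and k: "1 \<le> k" "k \<le> kappa s"
  shows "\<exists>D. projector N D
    \<and> (\<forall>u\<in>carrier_vec N. sval s k * vnorm (D *\<^sub>v u) \<le> vnorm (M *\<^sub>v u))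
    \<and> (\<forall>i<r. vnorm (D *\<^sub>v col (adj M) i - col (adj M) i) \<le> sval s (k + 1))"
proof -
  have len: "length s = r"
    using s M by (simp add: singular_values_def)
  define l where "l i = complex_of_real ((s ! i)\<^sup>2)" for i
  have Mc: "adj M \<in> carrier_mat N r" "M * adj M \<in> carrier_mat r r"
    using M by (auto simp: mult_carrier_mat [of _ r N])
  have hG: "adj (M * adj M) = M * adj M"
    using M Mc by (simp add: adj_mult [of _ r N _ r])
  have "char_poly (M * adj M) = (\<Prod>e\<leftarrow>map (\<lambda>\<sigma>. complex_of_real (\<sigma>\<^sup>2)) s. [:- e, 1:])"
    using s by (simp add: singular_values_def o_def)
  from hermitian_diagonalization [OF Mc(2) hG this]
  obtain Q where Q: "unitary_mat r Q"
    and dQ: "adj Q * (M * adj M) * Q = diag r ((!) (map (\<lambda>\<sigma>. complex_of_real (\<sigma>\<^sup>2)) s))"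
    by blast
  have Qc: "Q \<in> carrier_mat r r" "adj Q \<in> carrier_mat r r"
    using Q by (auto simp: unitary_mat_def)
  define Y where "Y = adj M * Q"
  have Yc: "Y \<in> carrier_mat N r" "adj Y \<in> carrier_mat r N"
    using Mc Qc by (auto simp: Y_def mult_carrier_mat [of _ N r])
  have adjY: "adj Y = adj Q * M"
    using Mc Qc by (simp add: Y_def adj_mult [of _ N r _ r])
  have "adj Y * Y = adj Q * (M * adj M) * Q"
    unfolding adjY unfolding Y_def using M Mc Qc
    by (smt (verit) assoc_mult_mat mult_carrier_mat)
  also have "\<dots> = diag r l"
    unfolding dQ by (intro diag_cong) (auto simp: l_def len)
  finally have YY: "adj Y * Y = diag r l" .
  \<comment> \<open>Dividing by the squared norms normalizes the first \<open>k\<close> columns. The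
    others get weight 0, so no vanishing singular value is inverted.\<close>
  define t where "t i = (if i < k then 1 / l i else 0)" for i
  define D where "D = Y * diag r t * adj Y"
  have Dc: "D \<in> carrier_mat N N"
    using Yc by (auto simp: D_def intro!: mult_carrier_mat [of _ N r])
  have pos: "0 < s ! i" if "i < k" for i
    using kappa_pos(2) [OF s] k that by simp
  have l0: "l i \<noteq> 0" if "i < k" for i
    using pos [OF that] by (simp add: l_def)
  have kr: "k \<le> r"
    using kappa_pos(1) [OF s, of "k - 1"] k len by linarith
  have YtY: "Y * diag r t \<in> carrier_mat N r" "diag r t * adj Y \<in> carrier_mat r N"
    using Yc by (auto simp: mult_carrier_mat [of _ N r] mult_carrier_mat [of _ r r])
  have adjD: "adj D = D"
  proof -
    have adjt: "adj (diag r t) = diag r t"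
      unfolding adj_diag by (intro diag_cong) (simp add: t_def l_def)
    have "adj D = Y * adj (Y * diag r t)"
      using Yc YtY by (simp add: D_def adj_mult [of _ N r _ N])
    also have "adj (Y * diag r t) = diag r t * adj Y"
      using Yc adjt by (simp add: adj_mult [of _ N r _ r])
    finally show ?thesis
      using Yc by (simp add: D_def assoc_mult_mat [of _ N r _ r _ N])
  qed
  have "D * D = Y * (diag r t * (adj Y * Y) * diag r t) * adj Y"
    unfolding D_def using Yc YtY diag_carrier [of r t]
    by (smt (verit) assoc_mult_mat mult_carrier_mat)
  also have "diag r t * (adj Y * Y) * diag r t = diag r t"
    unfolding YY diag_mult using l0 by (intro diag_cong) (simp add: t_def)
  finally have DD: "D * D = D"
    by (simp add: D_def)
  have "sval s k * vnorm (D *\<^sub>v u) \<le> vnorm (M *\<^sub>v u)" if u: "u \<in> carrier_vec N" for u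
  proof -
    define z where "z = adj Y *\<^sub>v u"
    have z: "z \<in> carrier_vec r"
      using Yc(2) u unfolding z_def by (rule mult_mat_vec_carrier)
    have "z = adj Q *\<^sub>v (M *\<^sub>v u)"
      using M Qc u by (simp add: z_def adjY assoc_mult_mat_vec [of _ r r _ N])
    then have nz: "vnorm2 z = vnorm2 (M *\<^sub>v u)"
      using M Q u by (metis mult_mat_vec_carrier unitary_mat_adj vnorm_power2 vnorm_unitary)
    have tz: "diag r t *\<^sub>v z \<in> carrier_vec r"
      by (rule mult_mat_vec_carrier [OF diag_carrier z])
    have Du: "D *\<^sub>v u = Y *\<^sub>v (diag r t *\<^sub>v z)"
      using Yc YtY u z tz unfolding z_def by (simp add: D_def assoc_mult_mat_vec [of _ N r _ N]
          assoc_mult_mat_vec [of _ N r _ r])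
    \<comment> \<open>As \<open>D\<close> is idempotent and self-adjoint, the squared norm of
      \<open>D u\<close> is the quadratic form of \<open>D\<close> at \<open>u\<close>, a weighted
      sum over the coordinates of \<open>z\<close>.\<close>
    have "complex_of_real (vnorm2 (D *\<^sub>v u)) = braket (adj D *\<^sub>v (D *\<^sub>v u)) u"
      unfolding of_real_vnorm2 using Dc u by (intro braket_mult_mat_vec) auto
    also have "adj D *\<^sub>v (D *\<^sub>v u) = D *\<^sub>v u"
      using Dc u DD by (simp add: adjD flip: assoc_mult_mat_vec [of _ N N _ N])
    also have "braket (D *\<^sub>v u) u = braket u (D *\<^sub>v u)"
      using braket_mult_mat_vec [OF Dc u u] by (simp add: adjD)
    also have "\<dots> = braket u (Y *\<^sub>v (diag r t *\<^sub>v z))"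
      by (simp only: Du)
    also have "\<dots> = braket z (diag r t *\<^sub>v z)"
      using tz Yc u unfolding z_def by (intro braket_mult_mat_vec) auto
    also have "\<dots> = complex_of_real (\<Sum>i<r. (if i < k then (cmod (z $ i))\<^sup>2 / (s ! i)\<^sup>2 else 0))"
      unfolding braket_diag [OF z] of_real_sum by (intro sum.cong) (auto simp: t_def l_def)
    finally have "vnorm2 (D *\<^sub>v u) = (\<Sum>i<r. (if i < k then (cmod (z $ i))\<^sup>2 / (s ! i)\<^sup>2 else 0))"
      by (simp only: of_real_eq_iff)
    also have "\<dots> \<le> (\<Sum>i<r. (cmod (z $ i))\<^sup>2 / (sval s k)\<^sup>2)"
    proof (intro sum_mono)
      fix i assume "i \<in> {..<r}"
      have "0 < sval s k"
        using pos [of "k - 1"] k kr len by (simp add: sval_def)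
      moreover have "sval s k \<le> s ! i" if "i < k"
        using singular_values_antimono [OF s, of i "k - 1"] that k kr len by (simp add: sval_def)
      ultimately show "(if i < k then (cmod (z $ i))\<^sup>2 / (s ! i)\<^sup>2 else 0) \<le> (cmod (z $ i))\<^sup>2 / (sval s k)\<^sup>2"
        by (auto intro!: divide_left_mono power_mono mult_pos_pos zero_less_power dest: pos)
    qed
    also have "\<dots> = vnorm2 z / (sval s k)\<^sup>2"
      using z by (simp add: vnorm2_def sum_divide_distrib)
    finally have "vnorm2 (D *\<^sub>v u) \<le> vnorm2 (M *\<^sub>v u) / (sval s k)\<^sup>2"
      by (simp add: nz)
    moreover have "0 < sval s k"
      using pos [of "k - 1"] k kr len by (simp add: sval_def)
    ultimately have "(sval s k)\<^sup>2 * vnorm2 (D *\<^sub>v u) \<le> vnorm2 (M *\<^sub>v u)"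
      by (simp add: field_simps)
    then have "(sval s k * vnorm (D *\<^sub>v u))\<^sup>2 \<le> (vnorm (M *\<^sub>v u))\<^sup>2"
      by (simp add: power_mult_distrib vnorm_power2)
    then show ?thesis
      by (rule power2_le_imp_le) simp
  qed
  moreover have "vnorm (D *\<^sub>v col (adj M) i - col (adj M) i) \<le> sval s (k + 1)" if i: "i < r" for i
  proof -
    define q where "q = adj Q *\<^sub>v unit_vec r i"
    have q: "q \<in> carrier_vec r"
      using Qc(2) unfolding q_def by (rule mult_mat_vec_carrier) simp
    have nq: "vnorm2 q = 1"
      using i vnorm_unitary [OF unitary_mat_adj [OF Q], of "unit_vec r i"]
      by (simp add: q_def vnorm_def)
    have "Y *\<^sub>v q = adj M *\<^sub>v (Q * adj Q *\<^sub>v unit_vec r i)"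
      using Mc Qc q unfolding Y_def q_def
      by (simp add: assoc_mult_mat_vec [of _ N r _ r] assoc_mult_mat_vec [of _ r r _ r])
    also have "\<dots> = col (adj M) i"
      using Mc i by (simp add: unitary_mat_right [OF Q] mult_unit_vec)
    finally have colM: "col (adj M) i = Y *\<^sub>v q" ..
    \<comment> \<open>\<open>z\<close> is the part of \<open>q\<close> with indices at least
      \<open>k\<close>; the difference \<open>D (Y q) - Y q\<close> is \<open>- Y z\<close>.\<close>
    define z where "z = diag r (\<lambda>i. if i < k then 0 else 1) *\<^sub>v q"
    have z: "z \<in> carrier_vec r"
      unfolding z_def by (rule mult_mat_vec_carrier [OF diag_carrier q])
    have Yq: "Y *\<^sub>v q \<in> carrier_vec N" "adj Y *\<^sub>v (Y *\<^sub>v q) \<in> carrier_vec r"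
      using Yc q by (auto intro!: mult_mat_vec_carrier)
    have "D *\<^sub>v (Y *\<^sub>v q) = Y *\<^sub>v (diag r t *\<^sub>v ((adj Y * Y) *\<^sub>v q))"
      using Yc YtY q Yq by (simp add: D_def assoc_mult_mat_vec [of _ N r _ N]
          assoc_mult_mat_vec [of _ N r _ r] assoc_mult_mat_vec [of _ r N _ r])
    also have "diag r t *\<^sub>v ((adj Y * Y) *\<^sub>v q) = q - z"
      using q l0 by (intro eq_vecI) (auto simp: YY z_def diag_mult_vec t_def)
    also have "Y *\<^sub>v (q - z) - Y *\<^sub>v q = - (Y *\<^sub>v z)"
      using q z Yc by (simp add: mult_minus_distrib_mat_vec [of _ N r]) (intro eq_vecI; auto)
    finally have "vnorm (D *\<^sub>v col (adj M) i - col (adj M) i) = vnorm (Y *\<^sub>v z)"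
      by (simp add: colM)
    moreover have "vnorm2 (Y *\<^sub>v z) \<le> (sval s (k + 1))\<^sup>2"
    proof -
      have "complex_of_real (vnorm2 (Y *\<^sub>v z)) = braket (adj Y *\<^sub>v (Y *\<^sub>v z)) z"
        unfolding of_real_vnorm2 using Yc z by (intro braket_mult_mat_vec) auto
      also have "\<dots> = braket z (adj Y *\<^sub>v (Y *\<^sub>v z))"
        using braket_mult_mat_vec [of "adj Y * Y" r r z z] Yc z
        by (simp add: adj_mult [of _ r N _ r] mult_carrier_mat [of _ r N] assoc_mult_mat_vec [of _ r N _ r])
      also have "adj Y *\<^sub>v (Y *\<^sub>v z) = diag r l *\<^sub>v z"
        using Yc z by (simp flip: YY add: assoc_mult_mat_vec [of _ r N _ r])
      also have "braket z (diag r l *\<^sub>v z) = complex_of_real (\<Sum>i<r. (s ! i)\<^sup>2 * (cmod (z $ i))\<^sup>2)"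
        unfolding braket_diag [OF z] of_real_sum by (intro sum.cong) (auto simp: l_def)
      finally have "vnorm2 (Y *\<^sub>v z) = (\<Sum>i<r. (s ! i)\<^sup>2 * (cmod (z $ i))\<^sup>2)"
        by (simp only: of_real_eq_iff)
      also have "\<dots> \<le> (\<Sum>i<r. (sval s (k + 1))\<^sup>2 * (cmod (q $ i))\<^sup>2)"
      proof (intro sum_mono)
        fix i assume i: "i \<in> {..<r}"
        \<comment> \<open>\<open>sval\<close> counts from 1 and \<open>!\<close> from 0, so
          \<open>sval s (k + 1)\<close> is \<open>s ! k\<close>, the largest of the discarded
          values.\<close>
        have "(s ! i)\<^sup>2 \<le> (sval s (k + 1))\<^sup>2" if "\<not> i < k"
          using singular_values_antimono [OF s, of k i] i that s len
          by (auto simp: sval_def singular_values_def intro!: power_mono)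
        then show "(s ! i)\<^sup>2 * (cmod (z $ i))\<^sup>2 \<le> (sval s (k + 1))\<^sup>2 * (cmod (q $ i))\<^sup>2"
          using i q by (auto simp: z_def diag_mult_vec intro!: mult_right_mono)
      qed
      also have "\<dots> = (sval s (k + 1))\<^sup>2"
        using nq q by (simp add: vnorm2_def flip: sum_distrib_left)
      finally show ?thesis .
    qed
    moreover have "0 \<le> sval s (k + 1)"
      using s by (auto simp: sval_def singular_values_def)
    ultimately show ?thesis
      by (simp add: vnorm_def real_le_lsqrt)
  qed
  ultimately show ?thesis
    using Dc adjD DD by (intro exI [of _ D]) (simp add: projector_def)
qed

section \<open>Adding a qubit\<close>

lemma zero_mat_mult_vec: "u \<in> carrier_vec b \<Longrightarrow> 0\<^sub>m a b *\<^sub>v u = 0\<^sub>v a"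
  by (intro eq_vecI) auto

lemma mat_mult_zero_vec: "A \<in> carrier_mat a b \<Longrightarrow> A *\<^sub>v 0\<^sub>v b = 0\<^sub>v a"
  by (intro eq_vecI) auto

lemma smult_mat_mult_vec:
  fixes c :: complex
  shows "A \<in> carrier_mat a b \<Longrightarrow> u \<in> carrier_vec b \<Longrightarrow> c \<cdot>\<^sub>m A *\<^sub>v u = c \<cdot>\<^sub>v (A *\<^sub>v u)"
  by (intro eq_vecI) auto

text \<open>The new qubit is the least significant bit of the index, because the query operator puts the
  workspace last.\<close>

definition vec2 :: "nat \<Rightarrow> complex vec \<Rightarrow> complex vec \<Rightarrow> complex vec" where
  "vec2 N p q = vec (2 * N) (\<lambda>r. (if even r then p else q) $ (r div 2))"

definition mat2 :: "nat \<Rightarrow> complex mat \<Rightarrow> complex mat \<Rightarrow> complex mat \<Rightarrow> complex mat \<Rightarrow> complex mat" where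
  "mat2 N A B C D = mat (2 * N) (2 * N) (\<lambda>(r, c).
     (if even r then if even c then A else B else if even c then C else D) $$ (r div 2, c div 2))"

lemma vec2_carrier [simp]: "vec2 N p q \<in> carrier_vec (2 * N)"
  by (simp add: vec2_def)

lemma dim_vec2 [simp]: "dim_vec (vec2 N p q) = 2 * N"
  by (simp add: vec2_def)

lemma mat2_carrier [simp]: "mat2 N A B C D \<in> carrier_mat (2 * N) (2 * N)"
  by (simp add: mat2_def)

lemma sum_lessThan_double:
  fixes g :: "nat \<Rightarrow> 'a :: comm_monoid_add"
  shows "(\<Sum>t<2 * N. g t) = (\<Sum>e<N. g (2 * e)) + (\<Sum>e<N. g (2 * e + 1))"
  by (induction N) (simp_all add: algebra_simps)

lemma div_2_less: "r < 2 * N \<Longrightarrow> r div 2 < (N::nat)"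
  by linarith

lemma vnorm2_vec2:
  assumes "p \<in> carrier_vec N" "q \<in> carrier_vec N"
  shows "vnorm2 (vec2 N p q) = vnorm2 p + vnorm2 q"
  using assms by (simp add: vnorm2_def sum_lessThan_double vec2_def)

lemma vec2_add: "p \<in> carrier_vec N \<Longrightarrow> q \<in> carrier_vec N \<Longrightarrow> p' \<in> carrier_vec N \<Longrightarrow> q' \<in> carrier_vec N
  \<Longrightarrow> vec2 N p q + vec2 N p' q' = vec2 N (p + p') (q + q')"
  by (intro eq_vecI) (auto simp: vec2_def div_2_less)

lemma vec2_minus: "p \<in> carrier_vec N \<Longrightarrow> q \<in> carrier_vec N \<Longrightarrow> p' \<in> carrier_vec N \<Longrightarrow> q' \<in> carrier_vec N
  \<Longrightarrow> vec2 N p q - vec2 N p' q' = vec2 N (p - p') (q - q')"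
  by (intro eq_vecI) (auto simp: vec2_def div_2_less)

lemma vec2_smult: "p \<in> carrier_vec N \<Longrightarrow> q \<in> carrier_vec N
  \<Longrightarrow> a \<cdot>\<^sub>v vec2 N p q = vec2 N (a \<cdot>\<^sub>v p) (a \<cdot>\<^sub>v q)"
  by (intro eq_vecI) (auto simp: vec2_def div_2_less)

lemma vec2_inject:
  assumes "vec2 N p q = vec2 N p' q'"
    and c: "p \<in> carrier_vec N" "q \<in> carrier_vec N" "p' \<in> carrier_vec N" "q' \<in> carrier_vec N"
  shows "p = p'" "q = q'"
proof -
  have *: "vec2 N p q $ r = vec2 N p' q' $ r" for r
    using assms by simp
  have "p $ i = p' $ i" "q $ i = q' $ i" if "i < N" for i
    using *[of "2 * i"] *[of "2 * i + 1"] that by (auto simp: vec2_def)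
  then show "p = p'" "q = q'"
    using c by (auto intro!: eq_vecI)
qed

lemma vec2_cases:
  assumes "z \<in> carrier_vec (2 * N)"
  obtains p q where "p \<in> carrier_vec N" "q \<in> carrier_vec N" "z = vec2 N p q"
proof
  show "z = vec2 N (vec N (\<lambda>e. z $ (2 * e))) (vec N (\<lambda>e. z $ (2 * e + 1)))"
    using assms by (intro eq_vecI) (auto simp: vec2_def div_2_less)
qed auto

lemma mat2_mult_vec2:
  assumes "A \<in> carrier_mat N N" "B \<in> carrier_mat N N" "C \<in> carrier_mat N N" "D \<in> carrier_mat N N"
    and "p \<in> carrier_vec N" "q \<in> carrier_vec N"
  shows "mat2 N A B C D *\<^sub>v vec2 N p q = vec2 N (A *\<^sub>v p + B *\<^sub>v q) (C *\<^sub>v p + D *\<^sub>v q)"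
proof (rule eq_vecI)
  fix r assume "r < dim_vec (vec2 N (A *\<^sub>v p + B *\<^sub>v q) (C *\<^sub>v p + D *\<^sub>v q))"
  then have r: "r < 2 * N" "r div 2 < N" by auto
  have "(mat2 N A B C D *\<^sub>v vec2 N p q) $ r
      = (\<Sum>t<2 * N. mat2 N A B C D $$ (r, t) * vec2 N p q $ t)"
    using r by (simp add: mat2_def scalar_prod_def lessThan_atLeast0)
  also have "\<dots> = vec2 N (A *\<^sub>v p + B *\<^sub>v q) (C *\<^sub>v p + D *\<^sub>v q) $ r"
    unfolding sum_lessThan_double using r assms
    by (simp add: mat2_def vec2_def scalar_prod_def lessThan_atLeast0)
  finally show "(mat2 N A B C D *\<^sub>v vec2 N p q) $ r
    = vec2 N (A *\<^sub>v p + B *\<^sub>v q) (C *\<^sub>v p + D *\<^sub>v q) $ r" .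
qed (simp add: mat2_def)

lemma mat2_mult:
  assumes "A \<in> carrier_mat N N" "B \<in> carrier_mat N N" "C \<in> carrier_mat N N" "D \<in> carrier_mat N N"
    and "A' \<in> carrier_mat N N" "B' \<in> carrier_mat N N" "C' \<in> carrier_mat N N" "D' \<in> carrier_mat N N"
  shows "mat2 N A B C D * mat2 N A' B' C' D'
    = mat2 N (A * A' + B * C') (A * B' + B * D') (C * A' + D * C') (C * B' + D * D')"
    (is "_ = ?R")
proof (rule eq_matI)
  fix r c assume "r < dim_row ?R" "c < dim_col ?R"
  then have r: "r < 2 * N" "r div 2 < N" "c < 2 * N" "c div 2 < N" by (auto simp: mat2_def)
  have "(mat2 N A B C D * mat2 N A' B' C' D') $$ (r, c)
      = (\<Sum>t<2 * N. mat2 N A B C D $$ (r, t) * mat2 N A' B' C' D' $$ (t, c))"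
    using r by (simp add: mat2_def scalar_prod_def lessThan_atLeast0)
  also have "\<dots> = ?R $$ (r, c)"
    unfolding sum_lessThan_double using r assms
    by (simp add: mat2_def scalar_prod_def lessThan_atLeast0)
  finally show "(mat2 N A B C D * mat2 N A' B' C' D') $$ (r, c) = ?R $$ (r, c)" .
qed (simp_all add: mat2_def)

lemma adj_mat2:
  assumes "A \<in> carrier_mat N N" "B \<in> carrier_mat N N" "C \<in> carrier_mat N N" "D \<in> carrier_mat N N"
  shows "adj (mat2 N A B C D) = mat2 N (adj A) (adj C) (adj B) (adj D)"
  using assms by (intro eq_matI) (auto simp: mat2_def div_2_less)

lemma mat2_one: "mat2 N (1\<^sub>m N) (0\<^sub>m N N) (0\<^sub>m N N) (1\<^sub>m N) = 1\<^sub>m (2 * N)"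
proof (intro eq_matI)
  fix i j assume "i < dim_row (1\<^sub>m (2 * N))" "j < dim_col (1\<^sub>m (2 * N))"
  then have "i < 2 * N" "j < 2 * N" "i div 2 < N" "j div 2 < N" by auto
  moreover have "i = j \<longleftrightarrow> i div 2 = j div 2 \<and> (even i \<longleftrightarrow> even j)"
    by (metis even_two_times_div_two odd_two_times_div_two_succ)
  ultimately show "mat2 N (1\<^sub>m N) (0\<^sub>m N N) (0\<^sub>m N N) (1\<^sub>m N) $$ (i, j) = 1\<^sub>m (2 * N) $$ (i, j)"
    by (auto simp: mat2_def)
qed (auto simp: mat2_def)

lemma unitary_mat2_diag:
  assumes "unitary_mat N A" "unitary_mat N D"
  shows "unitary_mat (2 * N) (mat2 N A (0\<^sub>m N N) (0\<^sub>m N N) D)"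
proof -
  have "adj (0\<^sub>m N N) = 0\<^sub>m N N"
    by (intro eq_matI) auto
  then show ?thesis
    using assms by (simp add: unitary_mat_def adj_mat2 mat2_mult mat2_one
        left_mult_zero_mat [of _ N N] right_mult_zero_mat [of _ N N])
qed

section \<open>Rabi oscillation driven by a unitary\<close>

text \<open>First \<open>U\<close>, controlled on the qubit being 1, then a rotation of the qubit by
  \<open>d\<close>.\<close>

definition rabi :: "nat \<Rightarrow> real \<Rightarrow> complex mat \<Rightarrow> complex mat" where
  "rabi N d U = mat2 N (complex_of_real (cos d) \<cdot>\<^sub>m 1\<^sub>m N) (complex_of_real (- sin d) \<cdot>\<^sub>m U)
     (complex_of_real (sin d) \<cdot>\<^sub>m 1\<^sub>m N) (complex_of_real (cos d) \<cdot>\<^sub>m U)"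

lemma rabi_carrier [simp]: "rabi N d U \<in> carrier_mat (2 * N) (2 * N)"
  by (simp add: rabi_def)

lemma dim_rabi [simp]: "dim_row (rabi N d U) = 2 * N" "dim_col (rabi N d U) = 2 * N"
  by (simp_all add: rabi_def mat2_def)

lemma rabi_vec2:
  assumes "U \<in> carrier_mat N N" "p \<in> carrier_vec N" "q \<in> carrier_vec N"
  shows "rabi N d U *\<^sub>v vec2 N p q
    = vec2 N (complex_of_real (cos d) \<cdot>\<^sub>v p - complex_of_real (sin d) \<cdot>\<^sub>v (U *\<^sub>v q))
        (complex_of_real (sin d) \<cdot>\<^sub>v p + complex_of_real (cos d) \<cdot>\<^sub>v (U *\<^sub>v q))"
proof -
  have "U *\<^sub>v q \<in> carrier_vec N"
    using assms by (intro mult_mat_vec_carrier)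
  then show ?thesis
    using assms unfolding rabi_def
    by (subst mat2_mult_vec2)
      (auto simp: smult_mat_mult_vec [of _ N N] vec2_def div_2_less intro!: eq_vecI)
qed

lemma rabi_unitary:
  assumes "unitary_mat N U"
  shows "unitary_mat (2 * N) (rabi N d U)"
proof -
  have U: "U \<in> carrier_mat N N" "adj U \<in> carrier_mat N N" "adj U * U = 1\<^sub>m N"
    using assms by (auto simp: unitary_mat_def)
  have cs: "complex_of_real (cos d) * complex_of_real (cos d)
      + complex_of_real (sin d) * complex_of_real (sin d) = 1"
    by (metis of_real_1 of_real_add of_real_mult power2_eq_square sin_cos_squared_add2)
  let ?c = "complex_of_real (cos d)" and ?s = "complex_of_real (sin d)"
  have "adj (rabi N d U) * rabi N d U = mat2 N
      (?c \<cdot>\<^sub>m 1\<^sub>m N * (?c \<cdot>\<^sub>m 1\<^sub>m N) + ?s \<cdot>\<^sub>m 1\<^sub>m N * (?s \<cdot>\<^sub>m 1\<^sub>m N))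
      (?c \<cdot>\<^sub>m 1\<^sub>m N * (- ?s \<cdot>\<^sub>m U) + ?s \<cdot>\<^sub>m 1\<^sub>m N * (?c \<cdot>\<^sub>m U))
      (- ?s \<cdot>\<^sub>m adj U * (?c \<cdot>\<^sub>m 1\<^sub>m N) + ?c \<cdot>\<^sub>m adj U * (?s \<cdot>\<^sub>m 1\<^sub>m N))
      (- ?s \<cdot>\<^sub>m adj U * (- ?s \<cdot>\<^sub>m U) + ?c \<cdot>\<^sub>m adj U * (?c \<cdot>\<^sub>m U))"
    unfolding rabi_def using U by (simp add: adj_mat2 adj_smult mat2_mult)
  also have "?c \<cdot>\<^sub>m 1\<^sub>m N * (?c \<cdot>\<^sub>m 1\<^sub>m N) + ?s \<cdot>\<^sub>m 1\<^sub>m N * (?s \<cdot>\<^sub>m 1\<^sub>m N) = 1\<^sub>m N"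
    using cs by (simp add: mult_smult_assoc_mat [of _ N N _ N] mult_smult_distrib [of _ N N _ N])
      (intro eq_matI; auto)
  also have "?c \<cdot>\<^sub>m 1\<^sub>m N * (- ?s \<cdot>\<^sub>m U) + ?s \<cdot>\<^sub>m 1\<^sub>m N * (?c \<cdot>\<^sub>m U) = 0\<^sub>m N N"
    using U by (simp add: mult_smult_assoc_mat [of _ N N _ N] mult_smult_distrib [of _ N N _ N])
      (intro eq_matI; auto)
  also have "- ?s \<cdot>\<^sub>m adj U * (?c \<cdot>\<^sub>m 1\<^sub>m N) + ?c \<cdot>\<^sub>m adj U * (?s \<cdot>\<^sub>m 1\<^sub>m N) = 0\<^sub>m N N"
    using U by (simp add: mult_smult_assoc_mat [of _ N N _ N] mult_smult_distrib [of _ N N _ N])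
      (intro eq_matI; auto)
  also have "- ?s \<cdot>\<^sub>m adj U * (- ?s \<cdot>\<^sub>m U) + ?c \<cdot>\<^sub>m adj U * (?c \<cdot>\<^sub>m U) = 1\<^sub>m N"
    using U cs by (simp add: mult_smult_assoc_mat [of _ N N _ N] mult_smult_distrib [of _ N N _ N])
      (intro eq_matI; auto simp: add.commute)
  finally show ?thesis
    by (simp add: unitary_mat_def mat2_one)
qed

text \<open>Used with \<open>B = A\<close> to move a factor of a power to its other end, and with
  \<open>B\<close> acting as \<open>U\<close> on both components.\<close>

lemma pow_mat_commute:
  assumes "A \<in> carrier_mat k k" "B \<in> carrier_mat k k" "A * B = B * A"
  shows "A ^\<^sub>m j * B = B * A ^\<^sub>m j"
proof (induction j)
  case (Suc j)
  have c: "A ^\<^sub>m j \<in> carrier_mat k k"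
    using assms by simp
  have "A ^\<^sub>m Suc j * B = A ^\<^sub>m j * (B * A)"
    using assms c by (simp add: assoc_mult_mat [of _ k k _ k _ k])
  also have "\<dots> = B * A ^\<^sub>m j * A"
    using assms c Suc by (simp flip: assoc_mult_mat [of _ k k _ k _ k])
  finally show ?case
    using assms c by (simp add: assoc_mult_mat [of _ k k _ k _ k])
qed (use assms in auto)

lemma vnorm_le_vec2:
  assumes "p \<in> carrier_vec N" "q \<in> carrier_vec N"
  shows "vnorm p \<le> vnorm (vec2 N p q)" "vnorm q \<le> vnorm (vec2 N p q)"
  using assms by (simp_all add: vnorm_def vnorm2_vec2)

lemma vnorm_vec2_zero: "p \<in> carrier_vec N \<Longrightarrow> vnorm (vec2 N p (0\<^sub>v N)) = vnorm p"
  "p \<in> carrier_vec N \<Longrightarrow> vnorm (vec2 N (0\<^sub>v N) p) = vnorm p"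
  by (simp_all add: vnorm_def vnorm2_vec2)

text \<open>Off resonance: comparing the \<open>1\<close>-components of \<open>V\<^sup>j V = V V\<^sup>j\<close> on \<open>w\<close> shows that the
  part of the initial state that is a coboundary \<open>w - U w\<close> is hardly transferred.\<close>

lemma rabi_off_resonance:
  assumes U: "unitary_mat N U" and w: "w \<in> carrier_vec N" and e: "e \<in> carrier_vec N"
    and d: "0 \<le> sin d" "0 < cos d"
    and pq: "p \<in> carrier_vec N" "q \<in> carrier_vec N"
      "rabi N d U ^\<^sub>m j *\<^sub>v vec2 N (w - U *\<^sub>v w + e) (0\<^sub>v N) = vec2 N p q"
  shows "vnorm q \<le> 2 * tan d * vnorm w + vnorm e"
proof -
  let ?c = "complex_of_real (cos d)" and ?s = "complex_of_real (sin d)"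
  define V where "V = rabi N d U"
  define X where "X = V ^\<^sub>m j"
  define UU where "UU = mat2 N U (0\<^sub>m N N) (0\<^sub>m N N) U"
  have Uc: "U \<in> carrier_mat N N"
    using U by (simp add: unitary_mat_def)
  have Vc: "V \<in> carrier_mat (2 * N) (2 * N)" and Xc: "X \<in> carrier_mat (2 * N) (2 * N)"
    and UUc: "UU \<in> carrier_mat (2 * N) (2 * N)"
    by (auto simp: V_def X_def UU_def)
  have Xn: "vnorm (X *\<^sub>v z) = vnorm z" if "z \<in> carrier_vec (2 * N)" for z
    unfolding X_def V_def using that by (rule vnorm_unitary [OF unitary_mat_pow [OF rabi_unitary [OF U]]])
  \<comment> \<open>All blocks of \<open>V\<close> are multiples of the identity or of
    \<open>U\<close>, so \<open>V\<close> commutes with \<open>U\<close> acting on both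
    components.\<close>
  have "V * UU = UU * V"
    unfolding V_def UU_def rabi_def using Uc
    by (simp add: mat2_mult mult_smult_assoc_mat [of _ N N _ N] mult_smult_distrib [of _ N N _ N])
  then have XUU: "X * UU = UU * X"
    unfolding X_def by (intro pow_mat_commute [OF Vc UUc])
  have XV: "X * V = V * X"
    unfolding X_def by (intro pow_mat_commute [OF Vc Vc]) simp
  have Xcar: "X *\<^sub>v z \<in> carrier_vec (2 * N)" if "z \<in> carrier_vec (2 * N)" for z
    using Xc that by (rule mult_mat_vec_carrier)
  obtain g f where gf: "g \<in> carrier_vec N" "f \<in> carrier_vec N" "X *\<^sub>v vec2 N w (0\<^sub>v N) = vec2 N g f"
    by (rule vec2_cases [OF Xcar [OF vec2_carrier]])
  obtain h f' where hf: "h \<in> carrier_vec N" "f' \<in> carrier_vec N" "X *\<^sub>v vec2 N (0\<^sub>v N) w = vec2 N h f'"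
    by (rule vec2_cases [OF Xcar [OF vec2_carrier]])
  obtain ge fe where gfe: "ge \<in> carrier_vec N" "fe \<in> carrier_vec N" "X *\<^sub>v vec2 N e (0\<^sub>v N) = vec2 N ge fe"
    by (rule vec2_cases [OF Xcar [OF vec2_carrier]])
  have Ucar: "U *\<^sub>v z \<in> carrier_vec N" if "z \<in> carrier_vec N" for z
    using Uc that by (rule mult_mat_vec_carrier)
  have U0: "U *\<^sub>v 0\<^sub>v N = 0\<^sub>v N"
    using Uc by (rule mat_mult_zero_vec)
  \<comment> \<open>\<open>V\<close> takes \<open>(w, 0)\<close> to
    \<open>(cos d w, sin d w)\<close>. Evaluating \<open>X V\<close> and \<open>V X\<close> on
    \<open>(w, 0)\<close> and comparing second components relates \<open>f - U f\<close> to
    \<open>g - f'\<close>.\<close>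
  have "vec2 N (?c \<cdot>\<^sub>v g + ?s \<cdot>\<^sub>v h) (?c \<cdot>\<^sub>v f + ?s \<cdot>\<^sub>v f')
      = ?c \<cdot>\<^sub>v (X *\<^sub>v vec2 N w (0\<^sub>v N)) + ?s \<cdot>\<^sub>v (X *\<^sub>v vec2 N (0\<^sub>v N) w)"
    using gf hf by (simp add: vec2_smult vec2_add)
  also have "\<dots> = X *\<^sub>v (?c \<cdot>\<^sub>v vec2 N w (0\<^sub>v N) + ?s \<cdot>\<^sub>v vec2 N (0\<^sub>v N) w)"
    using Xc by (simp add: mult_add_distrib_mat_vec [of _ "2*N" "2*N"] mult_mat_vec [of _ "2*N" "2*N"])
  also have "?c \<cdot>\<^sub>v vec2 N w (0\<^sub>v N) + ?s \<cdot>\<^sub>v vec2 N (0\<^sub>v N) w = V *\<^sub>v vec2 N w (0\<^sub>v N)"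
    unfolding V_def using w Uc
    by (simp add: rabi_vec2 vec2_smult vec2_add U0) (intro arg_cong2 [of _ _ _ _ "vec2 N"] eq_vecI; auto)
  also have "X *\<^sub>v (V *\<^sub>v vec2 N w (0\<^sub>v N)) = V *\<^sub>v vec2 N g f"
    using Xc Vc XV gf by (metis assoc_mult_mat_vec vec2_carrier)
  also have "\<dots> = vec2 N (?c \<cdot>\<^sub>v g - ?s \<cdot>\<^sub>v (U *\<^sub>v f)) (?s \<cdot>\<^sub>v g + ?c \<cdot>\<^sub>v (U *\<^sub>v f))"
    unfolding V_def using Uc gf by (intro rabi_vec2)
  finally have eq: "?c \<cdot>\<^sub>v f + ?s \<cdot>\<^sub>v f' = ?s \<cdot>\<^sub>v g + ?c \<cdot>\<^sub>v (U *\<^sub>v f)"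
    by (rule vec2_inject(2)) (use gf hf Ucar [OF gf(2)] in auto)
  \<comment> \<open>Since \<open>X\<close> commutes with \<open>UU\<close>, it carries coboundaries
    to coboundaries: the image of \<open>(w - U w, 0)\<close> has second component
    \<open>f - U f\<close>.\<close>
  have "vec2 N p q = X *\<^sub>v (vec2 N w (0\<^sub>v N) - vec2 N (U *\<^sub>v w) (0\<^sub>v N) + vec2 N e (0\<^sub>v N))"
    using w e Ucar [OF w] pq(3) by (simp add: vec2_minus vec2_add X_def V_def)
  also have "vec2 N (U *\<^sub>v w) (0\<^sub>v N) = UU *\<^sub>v vec2 N w (0\<^sub>v N)"
    unfolding UU_def using w Uc Ucar [OF w] by (subst mat2_mult_vec2) (auto simp: U0 zero_mat_mult_vec)
  also have "X *\<^sub>v (vec2 N w (0\<^sub>v N) - UU *\<^sub>v vec2 N w (0\<^sub>v N) + vec2 N e (0\<^sub>v N))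
      = vec2 N g f - X *\<^sub>v (UU *\<^sub>v vec2 N w (0\<^sub>v N)) + vec2 N ge fe"
    using Xc mult_mat_vec_carrier [OF UUc vec2_carrier [of N w "0\<^sub>v N"]]
    by (simp add: mult_add_distrib_mat_vec [of _ "2*N" "2*N"] mult_minus_distrib_mat_vec [of _ "2*N" "2*N"] gf gfe)
  also have "X *\<^sub>v (UU *\<^sub>v vec2 N w (0\<^sub>v N)) = UU *\<^sub>v vec2 N g f"
    using Xc UUc XUU gf by (metis assoc_mult_mat_vec vec2_carrier)
  also have "UU *\<^sub>v vec2 N g f = vec2 N (U *\<^sub>v g) (U *\<^sub>v f)"
    unfolding UU_def using gf Uc Ucar [OF gf(1)] Ucar [OF gf(2)]
    by (subst mat2_mult_vec2) (auto simp: zero_mat_mult_vec)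
  also have "vec2 N g f - vec2 N (U *\<^sub>v g) (U *\<^sub>v f) + vec2 N ge fe
      = vec2 N (g - U *\<^sub>v g + ge) (f - U *\<^sub>v f + fe)"
    using gf gfe Ucar by (simp add: vec2_minus vec2_add)
  finally have q: "q = f - U *\<^sub>v f + fe"
    by (rule vec2_inject(2)) (use pq gf gfe Ucar [OF gf(1)] Ucar [OF gf(2)] in auto)
  have "f - U *\<^sub>v f = complex_of_real (tan d) \<cdot>\<^sub>v (g - f')"
  proof (intro eq_vecI)
    fix i assume "i < dim_vec (complex_of_real (tan d) \<cdot>\<^sub>v (g - f'))"
    then have i: "i < N" using hf by simp
    have "?c * f $ i + ?s * f' $ i = ?s * g $ i + ?c * (U *\<^sub>v f) $ i"
      using arg_cong [OF eq, of "\<lambda>v. v $ i"] i Uc gf hf by simp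
    then have "?c * (f $ i - (U *\<^sub>v f) $ i) = ?s * (g $ i - f' $ i)"
      by (simp add: algebra_simps)
    moreover have "?c \<noteq> 0"
      using d by simp
    ultimately show "(f - U *\<^sub>v f) $ i = (complex_of_real (tan d) \<cdot>\<^sub>v (g - f')) $ i"
      using i Uc gf hf by (simp add: tan_def field_simps)
  qed (use gf hf Uc in auto)
  moreover have "vnorm (g - f') \<le> vnorm w + vnorm w"
  proof -
    have "vnorm g \<le> vnorm w"
      using vnorm_le_vec2(1) [OF gf(1,2)] Xn [OF vec2_carrier, of w "0\<^sub>v N"] w gf
      by (simp add: vnorm_vec2_zero)
    moreover have "vnorm f' \<le> vnorm w"
      using vnorm_le_vec2(2) [OF hf(1,2)] Xn [OF vec2_carrier, of "0\<^sub>v N" w] w hf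
      by (simp add: vnorm_vec2_zero)
    ultimately show ?thesis
      using vnorm_minus_le [OF gf(1) hf(2)] by linarith
  qed
  moreover have "vnorm fe \<le> vnorm e"
    using vnorm_le_vec2(2) [OF gfe(1,2)] Xn [OF vec2_carrier, of e "0\<^sub>v N"] e gfe
    by (simp add: vnorm_vec2_zero)
  moreover have "0 \<le> tan d"
    using d by (simp add: tan_def)
  moreover have "vnorm q \<le> vnorm (f - U *\<^sub>v f) + vnorm fe"
    unfolding q using gf gfe Ucar [OF gf(2)] by (intro vnorm_triangle [of _ N]) auto
  ultimately show ?thesis
    using mult_left_mono [of "vnorm (g - f')" "vnorm w + vnorm w" "tan d"]
    by (simp add: vnorm_smult)
qed

text \<open>The product-to-sum formula makes the sum telescope. This evaluates the accumulated error
  of \<open>rabi_resonance\<close>.\<close>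

lemma sum_sin_bound:
  fixes d :: real
  shows "2 * sin (d / 2) * (\<Sum>j<k. sin (real j * d)) = cos (d / 2) - cos ((real k - 1 / 2) * d)"
proof (induction k)
  case (Suc k)
  have "2 * sin (d / 2) * sin (real k * d) = cos (real k * d - d / 2) - cos (real k * d + d / 2)"
    by (simp add: cos_add cos_diff)
  with Suc show ?case
    by (simp add: algebra_simps)
qed simp

text \<open>If \<open>U\<close> fixed \<open>\<psi>\<close>, every step would turn the state by
  \<open>d\<close> from \<open>(\<psi>, 0)\<close> towards \<open>(0, \<psi>)\<close>. In general
  \<open>U\<close> errs only on the second component, which at step \<open>j\<close> has weight
  \<open>sin (j * d)\<close>, and unitarity carries earlier errors along without growth. For a
  quarter turn the weights sum to about \<open>1 / d\<close>, whereas there are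
  \<open>pi / (2 * d)\<close> steps; the numerical constants rely on this gain.\<close>

lemma rabi_resonance:
  assumes U: "unitary_mat N U" and psi: "\<psi> \<in> carrier_vec N"
    and d: "0 \<le> d" "real k * d \<le> pi"
  shows "vnorm (rabi N d U ^\<^sub>m k *\<^sub>v vec2 N \<psi> (0\<^sub>v N)
      - vec2 N (complex_of_real (cos (real k * d)) \<cdot>\<^sub>v \<psi>) (complex_of_real (sin (real k * d)) \<cdot>\<^sub>v \<psi>))
    \<le> vnorm (U *\<^sub>v \<psi> - \<psi>) * (\<Sum>j<k. sin (real j * d))"
  using d(2)
proof (induction k)
  case 0
  have "vec2 N \<psi> (0\<^sub>v N) - vec2 N (1 \<cdot>\<^sub>v \<psi>) (0 \<cdot>\<^sub>v \<psi>) = 0\<^sub>v (2 * N)"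
    using psi by (intro eq_vecI) (auto simp: vec2_def div_2_less)
  moreover have "rabi N d U ^\<^sub>m 0 *\<^sub>v vec2 N \<psi> (0\<^sub>v N) = vec2 N \<psi> (0\<^sub>v N)"
    by simp
  ultimately show ?case by simp
next
  case (Suc k)
  let ?V = "rabi N d U" and ?a = "real k * d"
  have Uc: "U \<in> carrier_mat N N"
    using U by (simp add: unitary_mat_def)
  have Upsi: "U *\<^sub>v \<psi> \<in> carrier_vec N"
    using Uc psi by (rule mult_mat_vec_carrier)
  define z where "z a = vec2 N (complex_of_real (cos a) \<cdot>\<^sub>v \<psi>) (complex_of_real (sin a) \<cdot>\<^sub>v \<psi>)" for a
  have zc: "z a \<in> carrier_vec (2 * N)" for a
    by (simp add: z_def)
  define y where "y = ?V ^\<^sub>m k *\<^sub>v vec2 N \<psi> (0\<^sub>v N)"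
  have yc: "y \<in> carrier_vec (2 * N)"
    unfolding y_def by (intro mult_mat_vec_carrier [of _ "2 * N" "2 * N"]) auto
  have ka: "?a \<le> pi"
    using Suc.prems d(1) by (simp add: algebra_simps)
  then have IH: "vnorm (y - z ?a) \<le> vnorm (U *\<^sub>v \<psi> - \<psi>) * (\<Sum>j<k. sin (real j * d))"
    using Suc.IH unfolding y_def z_def by blast
  have sa: "0 \<le> sin ?a"
    using ka d(1) by (intro sin_ge_zero) auto
  have "?V ^\<^sub>m Suc k *\<^sub>v vec2 N \<psi> (0\<^sub>v N) = ?V *\<^sub>v y"
    using pow_mat_commute [of ?V "2 * N" ?V k]
    by (simp add: y_def assoc_mult_mat_vec [of _ "2 * N" "2 * N" _ "2 * N"])
  also have "?V *\<^sub>v y - z (?a + d) = ?V *\<^sub>v (y - z ?a) + (?V *\<^sub>v z ?a - z (?a + d))"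
    using yc zc mult_mat_vec_carrier [OF rabi_carrier zc] mult_mat_vec_carrier [OF rabi_carrier yc]
    by (subst mult_minus_distrib_mat_vec [of _ "2 * N" "2 * N"]) (auto intro!: eq_vecI simp: z_def)
  finally have "vnorm (?V ^\<^sub>m Suc k *\<^sub>v vec2 N \<psi> (0\<^sub>v N) - z (?a + d))
      \<le> vnorm (?V *\<^sub>v (y - z ?a)) + vnorm (?V *\<^sub>v z ?a - z (?a + d))"
    using yc zc mult_mat_vec_carrier [OF rabi_carrier zc]
      mult_mat_vec_carrier [OF rabi_carrier, of "y - z ?a" N d U]
    by (simp add: vnorm_triangle [of _ "2 * N"])
  also have "vnorm (?V *\<^sub>v (y - z ?a)) = vnorm (y - z ?a)"
    using yc zc by (intro vnorm_unitary [OF rabi_unitary [OF U]]) auto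
  also have "vnorm (?V *\<^sub>v z ?a - z (?a + d)) = sin ?a * vnorm (U *\<^sub>v \<psi> - \<psi>)"
  proof -
    \<comment> \<open>The defect of one step is \<open>sin ?a\<close> times the tensor product of
      the unit vector \<open>(- sin d, cos d)\<close> with \<open>U \<psi> - \<psi>\<close>.\<close>
    have "?V *\<^sub>v z ?a - z (?a + d) = vec2 N (complex_of_real (- sin d * sin ?a) \<cdot>\<^sub>v (U *\<^sub>v \<psi> - \<psi>))
        (complex_of_real (cos d * sin ?a) \<cdot>\<^sub>v (U *\<^sub>v \<psi> - \<psi>))"
      unfolding z_def using psi Uc Upsi
      by (simp add: rabi_vec2 mult_mat_vec [of _ N N] vec2_minus)
        (intro arg_cong2 [of _ _ _ _ "vec2 N"] eq_vecI;
          auto simp: cos_add sin_add algebra_simps)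
    also have "vnorm2 \<dots> = ((sin d)\<^sup>2 + (cos d)\<^sup>2) * ((sin ?a)\<^sup>2 * vnorm2 (U *\<^sub>v \<psi> - \<psi>))"
      using psi Upsi by (subst vnorm2_vec2)
        (auto simp: vnorm2_smult norm_mult power_mult_distrib simp flip: distrib_right mult.assoc)
    finally show ?thesis
      using sa by (simp add: vnorm_def real_sqrt_mult)
  qed
  finally show ?case
    using IH by (simp add: z_def algebra_simps)
qed

section \<open>Embedding into the query space\<close>

text \<open>Reads the index as a two-digit number with low digit in base \<open>b\<close>; both
  coordinate conventions are unpacked in this way.\<close>

lemma sum_div_mod:
  fixes g :: "nat \<Rightarrow> nat \<Rightarrow> 'a :: comm_monoid_add"
  assumes "0 < b"
  shows "(\<Sum>j<a * b. g (j div b) (j mod b)) = (\<Sum>i<a. \<Sum>k<b. g i k)"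
proof (induction a)
  case (Suc a)
  have "(\<Sum>j<Suc a * b. g (j div b) (j mod b))
      = (\<Sum>j<a * b. g (j div b) (j mod b)) + (\<Sum>j=a * b..<a * b + b. g (j div b) (j mod b))"
    by (simp add: lessThan_atLeast0 sum.atLeastLessThan_concat add.commute)
  also have "(\<Sum>j=a * b..<a * b + b. g (j div b) (j mod b)) = (\<Sum>k<b. g a k)"
    using sum.shift_bounds_nat_ivl [of "\<lambda>j. g (j div b) (j mod b)" 0 "a * b" b]
    by (simp add: lessThan_atLeast0 add.commute)
  finally show ?case using Suc by simp
qed simp

lemma sum_lessThan_1_plus:
  fixes g :: "nat \<Rightarrow> 'a :: comm_monoid_add"
  shows "(\<Sum>t<1 + k. g t) = g 0 + (\<Sum>j<k. g (1 + j))"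
  by (simp add: sum.lessThan_Suc_shift del: sum.lessThan_Suc)

text \<open>The paper's space becomes part of the query space with workspace \<open>\<complex>\<^bsup>m+1\<^esup>\<close>: the
  vector \<open>|i>|k>|b>\<close> goes to \<open>|i,b,k+1>\<close>, while the workspace value \<open>0\<close> is reserved for
  \<open>|0hat>\<close>, which goes to \<open>|0,0,0>\<close>.\<close>

definition emb :: "nat \<Rightarrow> nat \<Rightarrow> complex vec \<Rightarrow> complex vec" where
  "emb n m z = vec (qdim n (m + 1)) (\<lambda>e. if e = 0 then z $ 0 else if e mod (m + 1) = 0 then 0
     else z $ (1 + (e div (m + 1) div 2 * m + (e mod (m + 1) - 1)) * 2 + e div (m + 1) mod 2))"

lemma emb_carrier [simp]: "emb n m z \<in> carrier_vec (qdim n (m + 1))"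
  by (simp add: emb_def)

text \<open>Up to coordinates filled with 0, \<open>emb\<close> only rearranges entries, so it is an
  isometry; \<open>n \<ge> 1\<close> provides the slot for \<open>|0hat>\<close>.\<close>

lemma braket_emb:
  assumes n: "1 \<le> n" and u: "u \<in> carrier_vec (1 + n * m * 2)"
  shows "braket (emb n m u) (emb n m z) = braket u z"
proof -
  define H where "H t = cnj (u $ t) * z $ t" for t
  define G where "G j l = (if l = 0 then if j = 0 then H 0 else 0
      else H (1 + (j div 2 * m + (l - 1)) * 2 + j mod 2))" for j l :: nat
  have "braket (emb n m u) (emb n m z) = (\<Sum>e<n * 2 * (m + 1). G (e div (m + 1)) (e mod (m + 1)))"
    unfolding braket_def by (intro sum.cong) (auto simp: emb_def qdim_def G_def H_def div_eq_0_iff)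
  also have "\<dots> = (\<Sum>j<n * 2. \<Sum>l<m + 1. G j l)"
    by (rule sum_div_mod) simp
  also have "\<dots> = (\<Sum>j<n * 2. (if j = 0 then H 0 else 0) + (\<Sum>k<m. H (1 + (j div 2 * m + k) * 2 + j mod 2)))"
    unfolding add.commute [of m 1] sum_lessThan_1_plus by (simp add: G_def)
  also have "\<dots> = H 0 + (\<Sum>j<n * 2. \<Sum>k<m. H (1 + (j div 2 * m + k) * 2 + j mod 2))"
    using n by (simp add: sum.distrib)
  also have "(\<Sum>j<n * 2. \<Sum>k<m. H (1 + (j div 2 * m + k) * 2 + j mod 2))
      = (\<Sum>i<n. \<Sum>b<2. \<Sum>k<m. H (1 + (i * m + k) * 2 + b))"
    by (rule sum_div_mod [of 2 "\<lambda>i b. \<Sum>k<m. H (1 + (i * m + k) * 2 + b)" n]) simp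
  also have "\<dots> = (\<Sum>i<n. \<Sum>k<m. \<Sum>b<2. H (1 + (i * m + k) * 2 + b))"
    by (intro sum.cong refl sum.swap)
  also have "\<dots> = (\<Sum>l<n * m. \<Sum>b<2. H (1 + l * 2 + b))"
  proof (cases "m = 0")
    case False
    then show ?thesis
      using sum_div_mod [of m "\<lambda>i k. \<Sum>b<2. H (1 + (i * m + k) * 2 + b)" n] by simp
  qed simp
  also have "\<dots> = (\<Sum>j<n * m * 2. H (1 + j))"
    using sum_div_mod [of 2 "\<lambda>l b. H (1 + l * 2 + b)" "n * m"] by simp
  also have "H 0 + (\<Sum>j<n * m * 2. H (1 + j)) = braket u z"
    using u unfolding braket_def carrier_vecD [OF u] sum_lessThan_1_plus by (simp add: H_def)
  finally show ?thesis .
qed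

lemma vnorm2_emb:
  assumes "1 \<le> n" "u \<in> carrier_vec (1 + n * m * 2)"
  shows "vnorm2 (emb n m u) = vnorm2 u"
  using braket_emb [OF assms, of u] by (simp flip: of_real_vnorm2)

lemma Hvec_carrier [simp]: "Hvec n m a g \<in> carrier_vec (1 + n * m * 2)"
  by (simp add: Hvec_def)

lemma vnorm2_Hvec:
  "vnorm2 (Hvec n m a g) = (cmod a)\<^sup>2 + (\<Sum>i<n. \<Sum>k<m. (cmod (g i k False))\<^sup>2 + (cmod (g i k True))\<^sup>2)"
proof -
  have "dim_vec (Hvec n m a g) = 1 + n * m * 2"
    by (simp add: Hvec_def)
  then have "vnorm2 (Hvec n m a g) = (cmod a)\<^sup>2
      + (\<Sum>j<n * m * 2. (cmod (g (j div 2 div m) (j div 2 mod m) (odd (j mod 2))))\<^sup>2)"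
    unfolding vnorm2_def by (simp only: sum_lessThan_1_plus) (simp add: Hvec_def)
  also have "(\<Sum>j<n * m * 2. (cmod (g (j div 2 div m) (j div 2 mod m) (odd (j mod 2))))\<^sup>2)
      = (\<Sum>l<n * m. \<Sum>b<2. (cmod (g (l div m) (l mod m) (odd (b :: nat))))\<^sup>2)"
    by (rule sum_div_mod [of 2 "\<lambda>l b. (cmod (g (l div m) (l mod m) (odd b)))\<^sup>2"]) simp
  also have "\<dots> = (\<Sum>l<n * m. (cmod (g (l div m) (l mod m) False))\<^sup>2 + (cmod (g (l div m) (l mod m) True))\<^sup>2)"
    by (simp add: numeral_2_eq_2)
  also have "\<dots> = (\<Sum>i<n. \<Sum>k<m. (cmod (g i k False))\<^sup>2 + (cmod (g i k True))\<^sup>2)"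
  proof (cases "m = 0")
    case False
    then show ?thesis
      using sum_div_mod [of m "\<lambda>i k. (cmod (g i k False))\<^sup>2 + (cmod (g i k True))\<^sup>2" n] by simp
  qed simp
  finally show ?thesis .
qed

text \<open>The index arithmetic of \<open>emb\<close> and \<open>Hvec\<close> cancels, so
  \<open>psi\<close> and \<open>phi\<close> can be handled entry by entry in the query
  space.\<close>

lemma emb_Hvec:
  assumes "e < qdim n (m + 1)"
  shows "emb n m (a \<cdot>\<^sub>v Hvec n m b g) $ e = a * (if e = 0 then b else if e mod (m + 1) = 0 then 0
    else g (e div (m + 1) div 2) (e mod (m + 1) - 1) (odd (e div (m + 1))))"
proof (cases "e = 0 \<or> e mod (m + 1) = 0")
  case True
  then show ?thesis
    using assms by (auto simp: emb_def Hvec_def)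
next
  case False
  define j k where "j = e div (m + 1)" and "k = e mod (m + 1) - 1"
  define i where "i = j div 2"
  have km: "k < m"
    using False mod_less_divisor [of "m + 1" e] unfolding k_def by linarith
  have "j < n * 2"
    using assms by (simp add: j_def qdim_def less_mult_imp_div_less)
  then have "i < n"
    by (simp add: i_def)
  then have "i * m + k < n * m"
    using km mult_le_mono1 [of "i + 1" n m] by simp
  moreover have "1 + a * 2 + b < 1 + c * 2" if "a < c" "b < 2" for a b c :: nat
    using that by linarith
  ultimately have lt: "1 + (i * m + k) * 2 + j mod 2 < 1 + n * m * 2"
    by simp
  have d: "((i * m + k) * 2 + j mod 2) div 2 = i * m + k" "odd ((i * m + k) * 2 + j mod 2) = odd j"
    by simp_all
  have "(i * m + k) div m = i" "(i * m + k) mod m = k"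
    using km by simp_all
  then have "Hvec n m b g $ (1 + (i * m + k) * 2 + j mod 2) = g i k (odd j)"
    using lt d by (simp add: Hvec_def)
  then have "(a \<cdot>\<^sub>v Hvec n m b g) $ (1 + (i * m + k) * 2 + j mod 2) = a * g i k (odd j)"
    using lt by (simp only: index_smult_vec carrier_vecD [OF Hvec_carrier])
  moreover have "emb n m (a \<cdot>\<^sub>v Hvec n m b g) $ e = (a \<cdot>\<^sub>v Hvec n m b g) $ (1 + (i * m + k) * 2 + j mod 2)"
    using False assms unfolding i_def j_def k_def by (simp only: emb_def index_vec if_False de_Morgan_disj)
  ultimately show ?thesis
    using False unfolding i_def j_def k_def by (simp only: if_False de_Morgan_disj)
qed

section \<open>Queries\<close>

text \<open>The permutation of basis indices behind \<open>query_op\<close>. Between truth values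
  \<open>\<noteq>\<close> is exclusive or, so \<open>|i,b,w>\<close> goes to
  \<open>|i, b xor x_i, w>\<close>.\<close>

definition oracle_index :: "nat \<Rightarrow> bool list \<Rightarrow> nat \<Rightarrow> nat" where
  "oracle_index W x e = (e div W div 2 * 2 + (if odd (e div W) \<noteq> x ! (e div W div 2) then 1 else 0)) * W
     + e mod W"

lemma oracle_index_div_mod:
  assumes "0 < W"
  shows "oracle_index W x e mod W = e mod W"
    and "oracle_index W x e div W div 2 = e div W div 2"
    and "odd (oracle_index W x e div W) \<longleftrightarrow> odd (e div W) \<noteq> x ! (e div W div 2)"
  using assms by (auto simp: oracle_index_def)

lemma oracle_index_involution:
  assumes "0 < W"
  shows "oracle_index W x (oracle_index W x e) = e"
proof -
  have "oracle_index W x (oracle_index W x e)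
      = (e div W div 2 * 2 + (if odd (e div W) then 1 else 0)) * W + e mod W"
    unfolding oracle_index_def [of W x "oracle_index W x e"] oracle_index_div_mod [OF assms]
    by simp
  also have "e div W div 2 * 2 + (if odd (e div W) then 1 else 0) = e div W"
    by (simp add: mult.commute)
  finally show ?thesis by simp
qed

lemma oracle_index_less:
  assumes "e < qdim n W"
  shows "oracle_index W x e < qdim n W"
proof -
  have W: "0 < W"
    using assms by (auto simp: qdim_def intro: gr0I)
  have "e div W < n * 2"
    using assms by (simp add: qdim_def less_mult_imp_div_less)
  then have "e div W div 2 * 2 + (if odd (e div W) \<noteq> x ! (e div W div 2) then 1 else 0) < n * 2"
    by (auto simp: div_less_iff_less_mult [symmetric, of 2] dest: less_mult_imp_div_less)
  then have "(e div W div 2 * 2 + (if odd (e div W) \<noteq> x ! (e div W div 2) then 1 else 0) + 1) * W \<le> n * 2 * W"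
    by (intro mult_right_mono) auto
  then show ?thesis
    using mod_less_divisor [OF W, of e] unfolding oracle_index_def qdim_def add_mult_distrib by linarith
qed

lemma query_op_carrier [simp]: "query_op n W x \<in> carrier_mat (qdim n W) (qdim n W)"
  by (simp add: query_op_def)

text \<open>A permutation matrix moves coordinates by the inverse permutation, and
  \<open>oracle_index\<close> is its own inverse.\<close>

lemma query_op_mult_vec:
  assumes W: "0 < W" and u: "u \<in> carrier_vec (qdim n W)"
  shows "query_op n W x *\<^sub>v u = vec (qdim n W) (\<lambda>e. u $ oracle_index W x e)"
proof (rule eq_vecI)
  fix r assume "r < dim_vec (vec (qdim n W) (\<lambda>e. u $ oracle_index W x e))"
  then have r: "r < qdim n W" by simp
  have "(query_op n W x *\<^sub>v u) $ r
      = (\<Sum>c<qdim n W. (if r = oracle_index W x c then 1 else 0) * u $ c)"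
    using r u by (simp add: query_op_def scalar_prod_def lessThan_atLeast0 Let_def oracle_index_def)
  also have "\<dots> = (\<Sum>c<qdim n W. if c = oracle_index W x r then u $ c else 0)"
    by (intro sum.cong) (auto simp: oracle_index_involution [OF W])
  also have "\<dots> = u $ oracle_index W x r"
    using oracle_index_less [OF r, of x] by simp
  finally show "(query_op n W x *\<^sub>v u) $ r = vec (qdim n W) (\<lambda>e. u $ oracle_index W x e) $ r"
    using r by simp
qed (simp add: query_op_def)

lemma oracle_index_double:
  "oracle_index (2 * W) x r = 2 * oracle_index W x (r div 2) + r mod 2"
proof -
  have "r div (2 * W) = r div 2 div W" "r mod (2 * W) = 2 * (r div 2 mod W) + r mod 2"
    by (simp_all add: div_mult2_eq mod_mult2_eq)
  then show ?thesis
    by (simp add: oracle_index_def algebra_simps)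
qed

lemma qdim_double: "qdim n (2 * W) = 2 * qdim n W"
  by (simp add: qdim_def)

lemma query_op_vec2:
  assumes W: "0 < W" and p: "p \<in> carrier_vec (qdim n W)" "q \<in> carrier_vec (qdim n W)"
  shows "query_op n (2 * W) x *\<^sub>v vec2 (qdim n W) p q
    = vec2 (qdim n W) (query_op n W x *\<^sub>v p) (query_op n W x *\<^sub>v q)"
proof (rule eq_vecI)
  fix r assume "r < dim_vec (vec2 (qdim n W) (query_op n W x *\<^sub>v p) (query_op n W x *\<^sub>v q))"
  then have r: "r < 2 * qdim n W" "r div 2 < qdim n W"
    by auto
  have "oracle_index (2 * W) x r < 2 * qdim n W"
    using oracle_index_less [of r n "2 * W" x] r by (simp add: qdim_double)
  moreover have "even (oracle_index (2 * W) x r) = even r" "oracle_index (2 * W) x r div 2 = oracle_index W x (r div 2)"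
    by (auto simp: oracle_index_double)
  ultimately show "(query_op n (2 * W) x *\<^sub>v vec2 (qdim n W) p q) $ r
      = vec2 (qdim n W) (query_op n W x *\<^sub>v p) (query_op n W x *\<^sub>v q) $ r"
    using W p r by (simp add: query_op_mult_vec qdim_double vec2_def)
qed (simp add: query_op_def qdim_double)

text \<open>Conjugating the sign flip at \<open>b = 1\<close> by the query gives the reflection
  \<open>2 \<Pi>\<^sub>x - 1\<close> on the embedded space, where \<open>\<Pi>\<^sub>x\<close> projects onto \<open>|0hat>\<close> and the
  \<open>|i>|k>|x\<^sub>i>\<close>.\<close>

definition bit_sign :: "nat \<Rightarrow> nat \<Rightarrow> complex mat" where
  "bit_sign n W = diag (qdim n W) (\<lambda>e. if e mod W \<noteq> 0 \<and> odd (e div W) then - 1 else 1)"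

definition input_sign :: "nat \<Rightarrow> nat \<Rightarrow> bool list \<Rightarrow> complex mat" where
  "input_sign n W x = diag (qdim n W)
     (\<lambda>e. if e mod W \<noteq> 0 \<and> odd (e div W) \<noteq> x ! (e div W div 2) then - 1 else 1)"

lemma sign_carrier [simp]:
  "bit_sign n W \<in> carrier_mat (qdim n W) (qdim n W)"
  "input_sign n W x \<in> carrier_mat (qdim n W) (qdim n W)"
  by (simp_all add: bit_sign_def input_sign_def)

lemma unitary_diag_sign:
  "unitary_mat k (diag k (\<lambda>e. if P e then - 1 else 1))"
proof -
  have "diag k (\<lambda>e. cnj (if P e then - 1 else 1) * (if P e then - 1 else 1)) = 1\<^sub>m k"
    by (intro eq_matI) (auto simp: diag_def)
  then show ?thesis
    by (simp add: unitary_mat_def adj_diag diag_mult)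
qed

text \<open>One equation for each value of the control qubit: with nothing in between two queries
  cancel, and around \<open>bit_sign\<close> they shift its condition on \<open>b\<close> by the
  input bit.\<close>

lemma query_bit_sign_query:
  assumes W: "0 < W" and u: "u \<in> carrier_vec (qdim n W)"
  shows "query_op n W x *\<^sub>v (query_op n W x *\<^sub>v u) = u"
    and "query_op n W x *\<^sub>v (bit_sign n W *\<^sub>v (query_op n W x *\<^sub>v u)) = input_sign n W x *\<^sub>v u"
  using u by (auto simp: query_op_mult_vec [OF W] bit_sign_def input_sign_def diag_mult_vec
      oracle_index_less oracle_index_involution [OF W] oracle_index_div_mod [OF W] intro!: eq_vecI)

section \<open>The query algorithm\<close>

definition reflection :: "nat \<Rightarrow> complex mat \<Rightarrow> complex mat" where
  "reflection k D = 2 \<cdot>\<^sub>m D - 1\<^sub>m k"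

lemma reflection_mult_vec:
  assumes "D \<in> carrier_mat k k" "u \<in> carrier_vec k"
  shows "reflection k D *\<^sub>v u = 2 \<cdot>\<^sub>v (D *\<^sub>v u) - u"
  using assms by (simp add: reflection_def minus_mult_distrib_mat_vec [of _ k k] smult_mat_mult_vec [of _ k k])

lemma reflection_unitary:
  assumes "projector k D"
  shows "unitary_mat k (reflection k D)"
proof -
  have D: "D \<in> carrier_mat k k" "adj D = D" "D * D = D"
    using assms by (auto simp: projector_def)
  have c: "reflection k D \<in> carrier_mat k k"
    by (simp add: reflection_def minus_carrier_mat)
  have "adj (reflection k D) $$ (i, j) = reflection k D $$ (i, j)" if "i < k" "j < k" for i j
    using arg_cong [OF D(2), of "\<lambda>A. A $$ (i, j)"] that D(1) by (simp add: reflection_def)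
  then have "adj (reflection k D) = reflection k D"
    using c by (intro eq_matI) auto
  moreover have "reflection k D * reflection k D = 1\<^sub>m k"
  proof -
    have E: "2 \<cdot>\<^sub>m D \<in> carrier_mat k k"
      using D by simp
    have "reflection k D * reflection k D = 2 \<cdot>\<^sub>m D * reflection k D - reflection k D"
      using minus_mult_distrib_mat [OF E one_carrier_mat c] c by (simp add: reflection_def)
    also have "2 \<cdot>\<^sub>m D * reflection k D = 2 \<cdot>\<^sub>m D * (2 \<cdot>\<^sub>m D) - 2 \<cdot>\<^sub>m D"
      using mult_minus_distrib_mat [OF E E one_carrier_mat] right_mult_one_mat [OF E]
      by (simp add: reflection_def)
    also have "(2 \<cdot>\<^sub>m D) * (2 \<cdot>\<^sub>m D) = 4 \<cdot>\<^sub>m D"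
      using D by (simp add: mult_smult_assoc_mat [of _ k k _ k] mult_smult_distrib [of _ k k _ k])
        (intro eq_matI; auto)
    finally show ?thesis
      using D(1) by (intro eq_matI) (auto simp: reflection_def)
  qed
  ultimately show ?thesis
    using c by (simp add: unitary_mat_def)
qed

text \<open>\<open>run_alg\<close> makes no query before its first gate, so that gate is the
  identity. Each of the \<open>K\<close> pairs then realizes one \<open>rabi\<close> step at the
  cost of two queries.\<close>

definition gates :: "nat \<Rightarrow> nat \<Rightarrow> real \<Rightarrow> complex mat \<Rightarrow> nat \<Rightarrow> complex mat list" where
  "gates n W d D K = 1\<^sub>m (qdim n (2 * W)) # concat (replicate K
     [mat2 (qdim n W) (1\<^sub>m (qdim n W)) (0\<^sub>m (qdim n W) (qdim n W)) (0\<^sub>m (qdim n W) (qdim n W)) (bit_sign n W),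
      rabi (qdim n W) d (reflection (qdim n W) D)])"

lemma length_gates: "length (gates n W d D K) = 2 * K + 1"
  by (simp add: gates_def length_concat sum_list_replicate)

lemma gates_unitary:
  assumes "projector (qdim n W) D" "U \<in> set (gates n W d D K)"
  shows "unitary_mat (qdim n (2 * W)) U"
  using assms unfolding gates_def qdim_double
  by (auto simp: bit_sign_def split: if_splits
      intro!: unitary_mat2_diag unitary_diag_sign rabi_unitary reflection_unitary)

text \<open>The queries are not controlled themselves. On control value 0 they meet and cancel; on
  control value 1 they enclose \<open>bit_sign\<close> and produce
  \<open>input_sign\<close>.\<close>

lemma rabi_step:
  assumes W: "0 < W" and D: "D \<in> carrier_mat (qdim n W) (qdim n W)" and z: "z \<in> carrier_vec (2 * qdim n W)"
  shows "rabi (qdim n W) d (reflection (qdim n W) D) *\<^sub>v (query_op n (2 * W) x *\<^sub>v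
     (mat2 (qdim n W) (1\<^sub>m (qdim n W)) (0\<^sub>m (qdim n W) (qdim n W)) (0\<^sub>m (qdim n W) (qdim n W)) (bit_sign n W) *\<^sub>v
     (query_op n (2 * W) x *\<^sub>v z)))
   = rabi (qdim n W) d (reflection (qdim n W) D * input_sign n W x) *\<^sub>v z"
proof -
  let ?N = "qdim n W" and ?Q = "query_op n W x"
  obtain p q where pq: "p \<in> carrier_vec ?N" "q \<in> carrier_vec ?N" "z = vec2 ?N p q"
    using z by (rule vec2_cases)
  have Qc: "?Q *\<^sub>v u \<in> carrier_vec ?N" if "u \<in> carrier_vec ?N" for u
    using that by (intro mult_mat_vec_carrier [OF query_op_carrier])
  have Sc: "bit_sign n W *\<^sub>v u \<in> carrier_vec ?N" "input_sign n W x *\<^sub>v u \<in> carrier_vec ?N"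
    if "u \<in> carrier_vec ?N" for u
    using that by (auto intro: mult_mat_vec_carrier [OF sign_carrier(1)] mult_mat_vec_carrier [OF sign_carrier(2)])
  have R: "reflection ?N D \<in> carrier_mat ?N ?N" "reflection ?N D * input_sign n W x \<in> carrier_mat ?N ?N"
    using D by (auto simp: reflection_def intro!: mult_carrier_mat [of _ ?N ?N])
  have "mat2 ?N (1\<^sub>m ?N) (0\<^sub>m ?N ?N) (0\<^sub>m ?N ?N) (bit_sign n W) *\<^sub>v vec2 ?N u w = vec2 ?N u (bit_sign n W *\<^sub>v w)"
    if "u \<in> carrier_vec ?N" "w \<in> carrier_vec ?N" for u w
    using that Sc by (simp add: mat2_mult_vec2 zero_mat_mult_vec)
  then show ?thesis
    using pq R by (simp add: query_op_vec2 [OF W] Qc Sc query_bit_sign_query [OF W] rabi_vec2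
        assoc_mult_mat_vec [of _ ?N ?N _ ?N])
qed

lemma run_alg_gates:
  assumes W: "0 < W" and n: "0 < n" and D: "D \<in> carrier_mat (qdim n W) (qdim n W)"
  shows "run_alg n (2 * W) (gates n W d D K) x
    = rabi (qdim n W) d (reflection (qdim n W) D * input_sign n W x) ^\<^sub>m K
      *\<^sub>v vec2 (qdim n W) (unit_vec (qdim n W) 0) (0\<^sub>v (qdim n W))"
proof -
  let ?N = "qdim n W"
  let ?V = "rabi ?N d (reflection ?N D * input_sign n W x)"
  let ?step = "\<lambda>st U. U *\<^sub>v (query_op n (2 * W) x *\<^sub>v st)"
  let ?l = "[mat2 ?N (1\<^sub>m ?N) (0\<^sub>m ?N ?N) (0\<^sub>m ?N ?N) (bit_sign n W), rabi ?N d (reflection ?N D)]"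
  have "foldl ?step z (concat (replicate K ?l)) = ?V ^\<^sub>m K *\<^sub>v z" if "z \<in> carrier_vec (2 * ?N)" for z
    using that
  proof (induction K arbitrary: z)
    case (Suc K)
    have c: "?V *\<^sub>v z \<in> carrier_vec (2 * ?N)"
      using Suc.prems by (intro mult_mat_vec_carrier [OF rabi_carrier])
    have "foldl ?step z (concat (replicate (Suc K) ?l)) = foldl ?step (?V *\<^sub>v z) (concat (replicate K ?l))"
      using rabi_step [OF W D Suc.prems] by simp
    also have "\<dots> = ?V ^\<^sub>m Suc K *\<^sub>v z"
      using Suc.IH [OF c] Suc.prems by (simp add: assoc_mult_mat_vec [of _ "2 * ?N" "2 * ?N" _ "2 * ?N"])
    finally show ?case .
  qed simp
  moreover have "unit_vec (2 * ?N) 0 = vec2 ?N (unit_vec ?N 0) (0\<^sub>v ?N)"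
    using n W by (intro eq_vecI) (auto simp: vec2_def unit_vec_def div_2_less qdim_def)
  ultimately show ?thesis
    by (simp add: run_alg_def gates_def qdim_double)
qed

section \<open>Success probability\<close>

lemma sin_ge_cubic:
  fixes x :: real
  assumes "0 \<le> x"
  shows "x - x ^ 3 / 6 \<le> sin x"
proof -
  have "(\<Sum>m<3. sin_coeff m * x ^ m) = x"
    by (simp add: numeral_3_eq_3 sin_coeff_def)
  then have "\<bar>sin x - x\<bar> \<le> x ^ 3 / 6"
    using Maclaurin_sin_bound [of x 3] assms by (simp add: fact_numeral field_simps)
  then show ?thesis by linarith
qed

lemma cos_ge_quadratic: "1 - x\<^sup>2 / 2 \<le> cos (x :: real)"
proof -
  have "\<bar>sin (x / 2)\<bar>\<^sup>2 \<le> \<bar>x / 2\<bar>\<^sup>2"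
    by (intro power_mono abs_sin_x_le_abs_x abs_ge_zero)
  then show ?thesis
    using cos_double_sin [of "x / 2"] by (simp add: power_divide)
qed

text \<open>The constant 147 balances two errors that must both stay below
  \<open>1 / sqrt 3\<close>, about 0.577: more steps accumulate more error at resonance, while a
  larger angle leaks more off resonance. Rounding precedes the choice of \<open>angle\<close>, so
  that the total rotation is exactly \<open>pi / 2\<close>.\<close>

definition steps :: "real \<Rightarrow> nat" where
  "steps A = nat \<lceil>pi / 2 * 147 * A\<rceil>"

definition angle :: "real \<Rightarrow> real" where
  "angle A = pi / (2 * real (steps A))"

lemma steps_angle_bounds:
  assumes "1 \<le> A"
  shows "real (steps A) \<le> 295 * A" "0 < steps A" "real (steps A) * angle A = pi / 2"
    "0 < angle A" "angle A \<le> 1 / (147 * A)" "1 \<le> 148 * A * angle A"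
proof -
  \<comment> \<open>The crude bound \<open>pi / 2 \<le> 2\<close> gives \<open>294 * A\<close>, and
    rounding up adds at most \<open>1 \<le> A\<close>.\<close>
  have "pi / 2 * 147 * A \<le> 2 * 147 * A"
    using assms pi_half_le_two by (intro mult_right_mono) auto
  moreover have ceil: "pi / 2 * 147 * A \<le> real (steps A)" "real (steps A) < pi / 2 * 147 * A + 1"
    unfolding steps_def using assms by (simp_all add: of_nat_ceiling) linarith
  ultimately show "real (steps A) \<le> 295 * A"
    using assms by linarith
  have pos: "0 < pi / 2 * 147 * A"
    using assms by simp
  then have K: "0 < real (steps A)"
    using ceil by linarith
  then show "0 < steps A" "real (steps A) * angle A = pi / 2" "0 < angle A"
    by (simp_all add: angle_def)
  have "147 * A * pi \<le> 2 * real (steps A)"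
    using ceil by (simp add: algebra_simps)
  then show "angle A \<le> 1 / (147 * A)"
    using K assms by (simp add: angle_def field_simps)
  \<comment> \<open>The rounding term 2 is at most \<open>A * pi\<close>, which turns 147 into
    148.\<close>
  have "2 * real (steps A) \<le> 147 * A * pi + 2"
    using ceil by (simp add: algebra_simps)
  also have "\<dots> \<le> 147 * A * pi + A * pi"
    using assms pi_ge_two mult_mono [of 1 A 2 pi] by simp
  finally have "2 * real (steps A) \<le> 148 * A * pi"
    by (simp add: algebra_simps)
  then show "1 \<le> 148 * A * angle A"
    using K by (simp add: angle_def field_simps)
qed

text \<open>By the closed form the sum is at most \<open>1 / (2 * sin (d / 2))\<close>, about
  \<open>1 / d \<le> 148 * A\<close>. The factor 0.999 pays for replacing the sine by its argument,
  and \<open>148 / 0.999\<close> is below 148.2.\<close>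

lemma steps_sum_sin_bound:
  assumes "1 \<le> A"
  shows "(\<Sum>j<steps A. sin (real j * angle A)) \<le> 148.2 * A"
proof -
  define d where "d = angle A"
  note b = steps_angle_bounds [OF assms, folded d_def]
  have "147 * d \<le> 147 * A * d"
    using assms b(4) by simp
  also have "\<dots> \<le> 1"
    using b(5) assms by (simp add: field_simps)
  finally have "d \<le> 1 / 147"
    by simp
  then have "(d / 2)\<^sup>2 \<le> (1 / 294)\<^sup>2"
    using b(4) by (intro power_mono) auto
  then have "d / 2 * (1 - (d / 2)\<^sup>2 / 6) \<ge> d / 2 * (1 - (1 / 294)\<^sup>2 / 6)"
    using b(4) by (intro mult_left_mono) auto
  then have s: "0.999 * d \<le> 2 * sin (d / 2)"
    using sin_ge_cubic [of "d / 2"] b(4) by (simp add: power2_eq_square power3_eq_cube algebra_simps)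
  have ang: "(real (steps A) - 1 / 2) * d = pi / 2 - d / 2"
    using b(3) by (simp add: algebra_simps)
  have "1 * d \<le> real (steps A) * d"
    using b(2,4) by (intro mult_right_mono) auto
  \<comment> \<open>The subtracted cosine in the closed form is taken at
    \<open>pi / 2 - d / 2\<close>, hence nonnegative.\<close>
  then have "0 \<le> cos ((real (steps A) - 1 / 2) * d)"
    unfolding ang using b(3,4) by (intro cos_ge_zero) auto
  then have "2 * sin (d / 2) * (\<Sum>j<steps A. sin (real j * d)) \<le> 1"
    unfolding sum_sin_bound using cos_le_one [of "d / 2"] by linarith
  moreover have S: "0 \<le> (\<Sum>j<steps A. sin (real j * d))"
  proof (intro sum_nonneg sin_ge_zero)
    fix j assume "j \<in> {..<steps A}"
    then have "real j * d \<le> real (steps A) * d"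
      using b(4) by (intro mult_right_mono) auto
    then show "real j * d \<le> pi"
      using b(3) pi_ge_zero by linarith
  qed (use b(4) in auto)
  ultimately have "0.999 * d * (\<Sum>j<steps A. sin (real j * d)) \<le> 1"
    using mult_right_mono [OF s S] by linarith
  also have "1 \<le> 0.999 * d * (148.2 * A)"
  proof -
    have "0 < A * d"
      using assms b(4) by simp
    then show ?thesis
      using b(6) by (simp add: algebra_simps)
  qed
  finally show ?thesis
    using b(4) by (simp add: d_def)
qed

text \<open>As \<open>Z\<close> fixes \<open>\<psi>\<close>, \<open>U\<close> moves it only by
  \<open>2 * vnorm (D \<psi> - \<psi>)\<close>, so \<open>(\<psi>, 0)\<close> ends within 0.469 of
  \<open>(0, \<psi>)\<close>. Starting at \<open>u\<close> instead costs another 1/10. Thus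
  \<open>p\<close> has norm at most 0.57, and the other outcome has the remaining
  probability.\<close>

lemma resonant_success:
  assumes A: "1 \<le> A" and D: "projector N D" and Z: "unitary_mat N Z"
    and psi: "\<psi> \<in> carrier_vec N" "Z *\<^sub>v \<psi> = \<psi>"
    and u: "u \<in> carrier_vec N" "vnorm2 u = 1" "vnorm (u - \<psi>) \<le> 1 / 10"
    and Dpsi: "vnorm (D *\<^sub>v \<psi> - \<psi>) \<le> 1 / (2 * sqrt (1000 * cconst) * A)"
    and pq: "p \<in> carrier_vec N" "q \<in> carrier_vec N"
      "rabi N (angle A) (reflection N D * Z) ^\<^sub>m steps A *\<^sub>v vec2 N u (0\<^sub>v N) = vec2 N p q"
  shows "2 / 3 \<le> vnorm2 q"
proof -
  define U where "U = reflection N D * Z"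
  define X where "X = rabi N (angle A) U ^\<^sub>m steps A"
  have Dc: "D \<in> carrier_mat N N" and Zc: "Z \<in> carrier_mat N N"
    using D Z by (auto simp: projector_def unitary_mat_def)
  have U: "unitary_mat N U"
    unfolding U_def by (intro unitary_mat_mult reflection_unitary D Z)
  have X: "unitary_mat (2 * N) X"
    unfolding X_def by (intro unitary_mat_pow rabi_unitary U)
  have Xc: "X \<in> carrier_mat (2 * N) (2 * N)"
    using X by (simp add: unitary_mat_def)
  have Rc: "reflection N D \<in> carrier_mat N N"
    by (simp add: reflection_def minus_carrier_mat)
  have Dpsic: "D *\<^sub>v \<psi> \<in> carrier_vec N"
    using Dc psi by (intro mult_mat_vec_carrier)
  have "U *\<^sub>v \<psi> - \<psi> = 2 \<cdot>\<^sub>v (D *\<^sub>v \<psi> - \<psi>)"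
    using Dc Zc Rc psi Dpsic unfolding U_def
    by (simp add: assoc_mult_mat_vec [of _ N N _ N] reflection_mult_vec) (intro eq_vecI; auto)
  then have "vnorm (U *\<^sub>v \<psi> - \<psi>) = 2 * vnorm (D *\<^sub>v \<psi> - \<psi>)"
    by (simp add: vnorm_smult)
  also have "\<dots> \<le> 1 / (316 * A)"
  proof -
    \<comment> \<open>\<open>316\<^sup>2 = 99856\<close> lies just below
      \<open>1000 * cconst = 100000\<close>.\<close>
    have "316 \<le> sqrt (1000 * cconst)"
      by (rule real_le_rsqrt) (simp add: cconst_def)
    then have "1 / (2 * sqrt (1000 * cconst) * A) \<le> 1 / (2 * 316 * A)"
      using A by (intro divide_left_mono mult_right_mono mult_left_mono mult_pos_pos)
        (auto simp: cconst_def)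
    then have "2 * vnorm (D *\<^sub>v \<psi> - \<psi>) \<le> 2 * (1 / (2 * 316 * A))"
      using Dpsi by linarith
    then show ?thesis by simp
  qed
  finally have eta: "vnorm (U *\<^sub>v \<psi> - \<psi>) \<le> 1 / (316 * A)" .
  note b = steps_angle_bounds [OF A]
  have "vnorm (X *\<^sub>v vec2 N \<psi> (0\<^sub>v N) - vec2 N (complex_of_real (cos (real (steps A) * angle A)) \<cdot>\<^sub>v \<psi>)
        (complex_of_real (sin (real (steps A) * angle A)) \<cdot>\<^sub>v \<psi>))
      \<le> vnorm (U *\<^sub>v \<psi> - \<psi>) * (\<Sum>j<steps A. sin (real j * angle A))"
    unfolding X_def using b(3,4) pi_ge_zero by (intro rabi_resonance U psi) linarith+
  also have "\<dots> \<le> vnorm (U *\<^sub>v \<psi> - \<psi>) * (148.2 * A)"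
    by (intro mult_left_mono steps_sum_sin_bound A) simp
  also have "\<dots> \<le> 1 / (316 * A) * (148.2 * A)"
    using eta A by (intro mult_right_mono) auto
  also have "\<dots> \<le> 0.469"
    using A by simp
  also have "vec2 N (complex_of_real (cos (real (steps A) * angle A)) \<cdot>\<^sub>v \<psi>)
      (complex_of_real (sin (real (steps A) * angle A)) \<cdot>\<^sub>v \<psi>) = vec2 N (0\<^sub>v N) \<psi>"
    unfolding b(3) using psi by (simp add: cos_pi_half sin_pi_half) (intro arg_cong2 [of _ _ _ _ "vec2 N"] eq_vecI; auto)
  finally have res: "vnorm (X *\<^sub>v vec2 N \<psi> (0\<^sub>v N) - vec2 N (0\<^sub>v N) \<psi>) \<le> 0.469" .
  obtain p1 q1 where 1: "p1 \<in> carrier_vec N" "q1 \<in> carrier_vec N" "X *\<^sub>v vec2 N \<psi> (0\<^sub>v N) = vec2 N p1 q1"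
    by (rule vec2_cases [OF mult_mat_vec_carrier [OF Xc vec2_carrier]])
  obtain p2 q2 where 2: "p2 \<in> carrier_vec N" "q2 \<in> carrier_vec N" "X *\<^sub>v vec2 N (u - \<psi>) (0\<^sub>v N) = vec2 N p2 q2"
    by (rule vec2_cases [OF mult_mat_vec_carrier [OF Xc vec2_carrier]])
  have "\<psi> + (u - \<psi>) = u"
    using u psi by (intro eq_vecI) auto
  then have "vec2 N u (0\<^sub>v N) = vec2 N \<psi> (0\<^sub>v N) + vec2 N (u - \<psi>) (0\<^sub>v N)"
    using u psi by (simp add: vec2_add)
  then have "vec2 N p q = vec2 N (p1 + p2) (q1 + q2)"
    using pq(3) 1 2 mult_add_distrib_mat_vec [OF Xc, of "vec2 N \<psi> (0\<^sub>v N)" "vec2 N (u - \<psi>) (0\<^sub>v N)"]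
    by (simp add: X_def U_def vec2_add)
  then have p: "p = p1 + p2"
    by (rule vec2_inject(1)) (use pq 1 2 in auto)
  have "vnorm p1 \<le> vnorm (vec2 N p1 (q1 - \<psi>))"
    using 1 psi by (intro vnorm_le_vec2) auto
  also have "vec2 N p1 (q1 - \<psi>) = vec2 N p1 q1 - vec2 N (0\<^sub>v N) \<psi>"
    using 1 psi by (simp add: vec2_minus)
  finally have "vnorm p1 \<le> 0.469"
    using res 1 by simp
  moreover have "vnorm p2 \<le> 1 / 10"
  proof -
    have "vnorm p2 \<le> vnorm (X *\<^sub>v vec2 N (u - \<psi>) (0\<^sub>v N))"
      unfolding 2(3) by (intro vnorm_le_vec2 2)
    also have "\<dots> = vnorm (u - \<psi>)"
      using u psi by (simp add: vnorm_unitary [OF X] vnorm_vec2_zero)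
    finally show ?thesis using u by simp
  qed
  ultimately have "vnorm p \<le> 0.57"
    unfolding p using vnorm_triangle [OF 1(1) 2(1)] by simp
  then have "vnorm2 p \<le> 0.57\<^sup>2"
    unfolding vnorm_power2 [symmetric] by (intro power_mono) auto
  moreover have "vnorm2 p + vnorm2 q = 1"
    using vnorm_unitary [OF X vec2_carrier, of u "0\<^sub>v N"] pq u
    by (simp add: X_def U_def vnorm_def vnorm2_vec2)
  ultimately show ?thesis
    by (simp add: power2_eq_square)
qed

text \<open>\<open>D\<close> nearly annihilates \<open>\<phi>\<close>, so \<open>U\<close> takes
  \<open>Z \<phi>\<close> nearly to \<open>- \<phi>\<close>, and \<open>u\<close>, a multiple of
  \<open>\<phi> + Z \<phi>\<close>, is a coboundary up to an error. The error contributes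
  \<open>10.05 / 20 = 0.5025\<close> and the coboundary 0.0685; the square of their sum 0.571 is
  below 1/3.\<close>

lemma off_resonant_success:
  assumes A: "1 \<le> A" and D: "projector N D" and Z: "unitary_mat N Z" "Z * Z = 1\<^sub>m N"
    and phi: "\<phi> \<in> carrier_vec N" "vnorm \<phi> = 1"
    and u: "u \<in> carrier_vec N" "vnorm2 u = 1"
    and Zphi: "\<phi> + Z *\<^sub>v \<phi> = complex_of_real (2 / \<rho>) \<cdot>\<^sub>v u" "0 < \<rho>" "\<rho> \<le> 10.05 * A"
    and Dphi: "vnorm (D *\<^sub>v \<phi>) \<le> 1 / (20 * A)"
    and pq: "p \<in> carrier_vec N" "q \<in> carrier_vec N"
      "rabi N (angle A) (reflection N D * Z) ^\<^sub>m steps A *\<^sub>v vec2 N u (0\<^sub>v N) = vec2 N p q"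
  shows "2 / 3 \<le> vnorm2 p"
proof -
  define U where "U = reflection N D * Z"
  define X where "X = rabi N (angle A) U ^\<^sub>m steps A"
  have Dc: "D \<in> carrier_mat N N" and Zc: "Z \<in> carrier_mat N N"
    using D Z by (auto simp: projector_def unitary_mat_def)
  have U: "unitary_mat N U"
    unfolding U_def by (intro unitary_mat_mult reflection_unitary D Z)
  have X: "unitary_mat (2 * N) X"
    unfolding X_def by (intro unitary_mat_pow rabi_unitary U)
  have Rc: "reflection N D \<in> carrier_mat N N"
    by (simp add: reflection_def minus_carrier_mat)
  have Zphic: "Z *\<^sub>v \<phi> \<in> carrier_vec N" and Dphic: "D *\<^sub>v \<phi> \<in> carrier_vec N"
    using Zc Dc phi by (auto intro: mult_mat_vec_carrier)
  \<comment> \<open>\<open>Z\<close> is an involution, so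
    \<open>U w = (\<rho> / 2) (2 D \<phi> - \<phi>)\<close> and
    \<open>w - U w = u - \<rho> D \<phi>\<close>, which dictates \<open>e\<close>.\<close>
  define w where "w = complex_of_real (\<rho> / 2) \<cdot>\<^sub>v (Z *\<^sub>v \<phi>)"
  define e where "e = complex_of_real \<rho> \<cdot>\<^sub>v (D *\<^sub>v \<phi>)"
  have w: "w \<in> carrier_vec N" and e: "e \<in> carrier_vec N"
    using Zphic Dphic by (auto simp: w_def e_def)
  have "Z *\<^sub>v (Z *\<^sub>v \<phi>) = \<phi>"
    using Z(2) Zc phi by (simp flip: assoc_mult_mat_vec [of _ N N _ N])
  then have "U *\<^sub>v w = complex_of_real (\<rho> / 2) \<cdot>\<^sub>v (2 \<cdot>\<^sub>v (D *\<^sub>v \<phi>) - \<phi>)"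
    unfolding w_def U_def using Zc Rc Dc phi Zphic
    by (simp add: mult_mat_vec [of _ N N] assoc_mult_mat_vec [of _ N N _ N] reflection_mult_vec
        mult_carrier_mat [of _ N N])
  moreover have "u = complex_of_real (\<rho> / 2) \<cdot>\<^sub>v (\<phi> + Z *\<^sub>v \<phi>)"
    unfolding Zphi(1) using Zphi(2) by (simp add: smult_smult_assoc)
  ultimately have u_eq: "w - U *\<^sub>v w + e = u"
    unfolding w_def e_def using phi Zphic Dphic Dc Zc
    by (intro eq_vecI) (auto simp: algebra_simps)
  note b = steps_angle_bounds [OF A]
  have "147 * angle A \<le> 147 * A * angle A"
    using A b(4) by simp
  also have "\<dots> \<le> 1"
    using b(5) A by (simp add: field_simps)
  finally have d: "angle A \<le> 1 / 147"
    by simp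
  then have "(angle A)\<^sup>2 \<le> (1 / 147)\<^sup>2"
    using b(4) by (intro power_mono) auto
  then have c: "0.999 \<le> cos (angle A)"
    using cos_ge_quadratic [of "angle A"] by (simp add: power2_eq_square)
  have s: "0 \<le> sin (angle A)" "sin (angle A) \<le> angle A"
    using b(4) d pi_ge_two by (auto intro: sin_ge_zero sin_x_le_x)
  have "tan (angle A) \<le> angle A / 0.999"
    unfolding tan_def using s c by (intro frac_le) auto
  then have "tan (angle A) * \<rho> \<le> angle A / 0.999 * (10.05 * A)"
    using Zphi s b(4) by (intro mult_mono) auto
  also have "\<dots> \<le> 1 / (147 * A) / 0.999 * (10.05 * A)"
    using b(5) A by (intro mult_right_mono divide_right_mono) auto
  also have "\<dots> \<le> 0.0685"
    using A by simp
  finally have t: "tan (angle A) * \<rho> \<le> 0.0685" .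
  have "vnorm q \<le> 2 * tan (angle A) * vnorm w + vnorm e"
    using pq c s unfolding u_eq [symmetric] U_def [symmetric]
    by (intro rabi_off_resonance [OF U w e, of _ p q "steps A"]) auto
  also have "vnorm w = \<rho> / 2"
    using Zphi(2) phi by (simp add: w_def vnorm_smult vnorm_unitary [OF Z(1)])
  also have "vnorm e \<le> 0.5025"
  proof -
    have "vnorm e = \<rho> * vnorm (D *\<^sub>v \<phi>)"
      using Zphi(2) by (simp add: e_def vnorm_smult)
    also have "\<dots> \<le> 10.05 * A * (1 / (20 * A))"
      using Zphi Dphi A by (intro mult_mono) auto
    finally show ?thesis using A by simp
  qed
  finally have "vnorm q \<le> 0.571"
    using t by simp
  then have "vnorm2 q \<le> 0.571\<^sup>2"
    unfolding vnorm_power2 [symmetric] by (intro power_mono) auto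
  moreover have "vnorm2 p + vnorm2 q = 1"
    using vnorm_unitary [OF X vec2_carrier, of u "0\<^sub>v N"] pq u
    by (simp add: X_def U_def vnorm_def vnorm2_vec2)
  ultimately show ?thesis
    by (simp add: power2_eq_square)
qed

section \<open>The witness states\<close>

text \<open>For each \<open>i\<close> only the bit \<open>B i\<close> is populated, so every
  coefficient counts once. \<open>B\<close> is the input bit for \<open>psi\<close> and its negation
  for \<open>phi\<close>.\<close>

lemma vnorm2_Hvec_select:
  assumes "\<forall>i<n. dim_vec (v i) = m"
  shows "vnorm2 (Hvec n m a (\<lambda>i k b. if b = B i then c * (v i $ k) else 0))
    = (cmod a)\<^sup>2 + (cmod c)\<^sup>2 * (\<Sum>i<n. vnorm2 (v i))"
proof -
  have "(\<Sum>i<n. \<Sum>k<m. (cmod (if False = B i then c * (v i $ k) else 0))\<^sup>2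
      + (cmod (if True = B i then c * (v i $ k) else 0))\<^sup>2) = (\<Sum>i<n. (cmod c)\<^sup>2 * vnorm2 (v i))"
    using assms by (intro sum.cong)
      (auto simp: vnorm2_def norm_mult power_mult_distrib sum_distrib_left intro!: sum.cong)
  then show ?thesis
    by (simp add: vnorm2_Hvec sum_distrib_left)
qed

lemma psi_carrier [simp]: "psi n m A v x \<in> carrier_vec (1 + n * m * 2)"
  using Hvec_carrier by (simp add: psi_def)

lemma phi_carrier [simp]: "phi n m A v x \<in> carrier_vec (1 + n * m * 2)"
  using Hvec_carrier by (simp add: phi_def)

text \<open>\<open>psi\<close> is supported on \<open>|0hat>\<close> and on the bits
  \<open>b = x_i\<close>, where every sign is 1.\<close>

lemma input_sign_emb_psi:
  "input_sign n (m + 1) x *\<^sub>v emb n m (psi n m A v x) = emb n m (psi n m A v x)"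
proof (rule eq_vecI)
  fix e assume "e < dim_vec (emb n m (psi n m A v x))"
  then have e: "e < qdim n (m + 1)" by (simp add: emb_def)
  show "(input_sign n (m + 1) x *\<^sub>v emb n m (psi n m A v x)) $ e = emb n m (psi n m A v x) $ e"
    using e unfolding input_sign_def diag_mult_vec [OF emb_carrier] psi_def
    by (simp only: index_vec emb_Hvec) auto
qed (simp add: emb_def input_sign_def diag_def)

text \<open>Unit vectors with real inner product \<open>r\<close> are at squared distance
  \<open>2 - 2 * r\<close>. Here \<open>r = 1 / sqrt nu\<close>, and \<open>nu \<le> 1.01\<close>
  gives \<open>r \<ge> 0.995\<close>.\<close>

lemma emb_psi_near:
  assumes n: "1 \<le> n" and A: "1 \<le> A" and dim: "\<forall>i<n. dim_vec (v x i) = m"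
    and sz: "(\<Sum>i<n. vnorm2 (v x i)) \<le> A"
  shows "vnorm (unit_vec (qdim n (m + 1)) 0 - emb n m (psi n m A v x)) \<le> 1 / 10"
proof -
  define sz where "sz = (\<Sum>i<n. vnorm2 (v x i))"
  define r where "r = 1 / sqrt (nu n A v x)"
  define c where "c = complex_of_real (1 / sqrt (cconst * A))"
  have sz0: "0 \<le> sz"
    by (simp add: sz_def sum_nonneg)
  have nu: "nu n A v x = 1 + sz / (100 * A)"
    by (simp add: nu_def sz_def cconst_def)
  have szA: "sz / (100 * A) \<le> 1 / 100" "0 \<le> sz / (100 * A)"
    using sz sz0 A by (simp_all add: sz_def field_simps)
  have r2: "r\<^sup>2 * nu n A v x = 1"
    using szA by (simp add: r_def nu power_divide)
  have r0: "0 \<le> r"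
    using szA by (simp add: r_def nu)
  have "1 / 1.01 \<le> 1 / nu n A v x"
    using szA unfolding nu by (intro divide_left_mono) auto
  then have "0.995\<^sup>2 \<le> r\<^sup>2"
    using szA by (simp add: r_def nu power_divide power2_eq_square)
  then have r: "0.995 \<le> r"
    using r0 by (rule power2_le_imp_le)
  have "unit_vec (qdim n (m + 1)) 0 - emb n m (psi n m A v x)
      = emb n m (1 \<cdot>\<^sub>v Hvec n m (complex_of_real (1 - r))
          (\<lambda>i k b. if b = x ! i then - complex_of_real r * c * (v x i $ k) else 0))" (is "_ = ?R")
  proof (rule eq_vecI)
    fix e assume "e < dim_vec ?R"
    then have e: "e < qdim n (m + 1)" by (simp add: emb_def)
    show "(unit_vec (qdim n (m + 1)) 0 - emb n m (psi n m A v x)) $ e = ?R $ e"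
      using e carrier_vecD [OF emb_carrier [of n m "psi n m A v x"]]
      by (simp only: index_minus_vec emb_Hvec psi_def r_def [symmetric] c_def [symmetric]) auto
  qed (simp add: emb_def)
  then have "vnorm2 (unit_vec (qdim n (m + 1)) 0 - emb n m (psi n m A v x))
      = vnorm2 (Hvec n m (complex_of_real (1 - r))
          (\<lambda>i k b. if b = x ! i then - complex_of_real r * c * (v x i $ k) else 0))"
    using n by (simp only: vnorm2_emb Hvec_carrier one_smult_vec)
  also have "\<dots> = (1 - r)\<^sup>2 + (r * (1 / sqrt (100 * A)))\<^sup>2 * sz"
    using dim A by (simp only: vnorm2_Hvec_select sz_def norm_mult norm_of_real norm_minus_cancel c_def)
      (simp add: cconst_def power_mult_distrib power_divide)
  also have "\<dots> = (1 - r)\<^sup>2 + r\<^sup>2 * (nu n A v x - 1)"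
    using A by (simp add: nu power_mult_distrib power_divide)
  also have "\<dots> = 2 - 2 * r"
    using r2 by (simp add: algebra_simps power2_eq_square)
  also have "\<dots> \<le> (1 / 10)\<^sup>2"
    using r by (simp add: power2_eq_square)
  finally show ?thesis
    unfolding vnorm_def by (intro real_le_lsqrt) auto
qed

lemma mu_pos: "1 \<le> A \<Longrightarrow> 1 \<le> mu n A v x"
  by (simp add: mu_def cconst_def sum_nonneg)

text \<open>\<open>mu\<close> is at most \<open>101 * A\<^sup>2\<close>, and
  \<open>10.05\<^sup>2 = 101.0025\<close>.\<close>

lemma mu_upper:
  assumes A: "1 \<le> A" and sz: "(\<Sum>i<n. vnorm2 (v x i)) \<le> A"
  shows "sqrt (mu n A v x) \<le> 10.05 * A"
proof (rule real_le_lsqrt)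
  have "mu n A v x \<le> 1 + 100 * A * A"
    using sz A unfolding mu_def cconst_def by (intro add_left_mono mult_left_mono) auto
  also have "\<dots> \<le> (10.05 * A)\<^sup>2"
    using A mult_mono [of 1 A 1 A] by (simp add: power2_eq_square)
  finally show "mu n A v x \<le> (10.05 * A)\<^sup>2" .
qed (use A mu_pos [of A n v x] in auto)

lemma vnorm_emb_phi:
  assumes n: "1 \<le> n" and A: "1 \<le> A" and dim: "\<forall>i<n. dim_vec (v x i) = m"
  shows "vnorm (emb n m (phi n m A v x)) = 1"
proof -
  define sz where "sz = (\<Sum>i<n. vnorm2 (v x i))"
  have "vnorm2 (emb n m (phi n m A v x)) = vnorm2 (phi n m A v x)"
    by (rule vnorm2_emb [OF n phi_carrier])
  also have "\<dots> = 1 / mu n A v x * (1 + 100 * A * sz)"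
    unfolding phi_def using dim A mu_pos [OF A, of n v x]
    by (simp only: vnorm2_smult vnorm2_Hvec_select sz_def norm_minus_cancel norm_of_real)
      (simp add: power_divide cconst_def)
  also have "\<dots> = 1"
    using mu_pos [OF A, of n v x] by (simp add: mu_def cconst_def sz_def)
  finally show ?thesis
    by (simp add: vnorm_def)
qed

text \<open>Away from \<open>|0hat>\<close>, \<open>phi\<close> is supported on the bits opposite to
  the input, where the sign is -1; these terms cancel and the \<open>|0hat>\<close> component
  doubles.\<close>

lemma input_sign_emb_phi:
  assumes n: "1 \<le> n"
  shows "emb n m (phi n m A v x) + input_sign n (m + 1) x *\<^sub>v emb n m (phi n m A v x)
    = complex_of_real (2 / sqrt (mu n A v x)) \<cdot>\<^sub>v unit_vec (qdim n (m + 1)) 0" (is "?L = ?R")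
proof (rule eq_vecI)
  fix e assume "e < dim_vec ?R"
  then have e: "e < qdim n (m + 1)" by simp
  show "?L $ e = ?R $ e"
    using e unfolding input_sign_def diag_mult_vec [OF emb_carrier] phi_def
    by (simp only: index_add_vec dim_vec index_vec emb_Hvec) auto
qed (simp add: input_sign_def diag_def)

section \<open>Correctness of the algorithm\<close>

lemma input_sign_unitary: "unitary_mat (qdim n W) (input_sign n W x)"
  unfolding input_sign_def by (rule unitary_diag_sign)

lemma input_sign_square: "input_sign n W x * input_sign n W x = 1\<^sub>m (qdim n W)"
  unfolding input_sign_def diag_mult by (intro eq_matI) (auto simp: diag_def)

text \<open>The measurement of the control qubit, with outcome 1.\<close>

definition acceptance :: "nat \<Rightarrow> complex mat" where
  "acceptance N = mat2 N (0\<^sub>m N N) (0\<^sub>m N N) (0\<^sub>m N N) (1\<^sub>m N)"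

lemma acceptance_projector: "projector (2 * N) (acceptance N)"
proof -
  have "adj (0\<^sub>m N N) = 0\<^sub>m N N"
    by (intro eq_matI) auto
  then show ?thesis
    by (simp add: projector_def acceptance_def adj_mat2 mat2_mult)
qed

lemma acceptance_vec2:
  assumes "p \<in> carrier_vec N" "q \<in> carrier_vec N"
  shows "vnorm2 (acceptance N *\<^sub>v vec2 N p q) = vnorm2 q"
    and "vnorm2 ((1\<^sub>m (2 * N) - acceptance N) *\<^sub>v vec2 N p q) = vnorm2 p"
proof -
  have *: "acceptance N *\<^sub>v vec2 N p q = vec2 N (0\<^sub>v N) q"
    using assms by (simp add: acceptance_def mat2_mult_vec2 zero_mat_mult_vec)
  then show "vnorm2 (acceptance N *\<^sub>v vec2 N p q) = vnorm2 q"
    using assms by (simp add: vnorm2_vec2)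
  have "(1\<^sub>m (2 * N) - acceptance N) *\<^sub>v vec2 N p q = vec2 N p q - vec2 N (0\<^sub>v N) q"
    using * by (simp add: minus_mult_distrib_mat_vec [of _ "2 * N" "2 * N"] acceptance_def)
  also have "\<dots> = vec2 N p (0\<^sub>v N)"
    using assms by (simp add: vec2_minus)
  finally show "vnorm2 ((1\<^sub>m (2 * N) - acceptance N) *\<^sub>v vec2 N p q) = vnorm2 p"
    using assms by (simp add: vnorm2_vec2)
qed

lemma computes_from_projector:
  assumes n: "1 \<le> n" and m: "1 \<le> m" and A: "1 \<le> A"
    and dim: "\<forall>x\<in>X. \<forall>j<n. dim_vec (v x j) = m"
    and sz: "\<forall>x\<in>X. (\<Sum>j<n. vnorm2 (v x j)) \<le> A"
    and D: "projector (qdim n (m + 1)) D"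
    and one: "\<And>x. x \<in> X \<Longrightarrow> f x \<Longrightarrow> vnorm (D *\<^sub>v emb n m (psi n m A v x) - emb n m (psi n m A v x))
      \<le> 1 / (2 * sqrt (1000 * cconst) * A)"
    and zero: "\<And>x. x \<in> X \<Longrightarrow> \<not> f x \<Longrightarrow> vnorm (D *\<^sub>v emb n m (phi n m A v x)) \<le> 1 / (20 * A)"
  shows "computes n X f (2 * (m + 1)) (2 * steps A) (gates n (m + 1) (angle A) D (steps A))
    (acceptance (qdim n (m + 1)))"
proof -
  let ?N = "qdim n (m + 1)" and ?u = "unit_vec (qdim n (m + 1)) 0"
  have N: "0 < ?N"
    using n by (simp add: qdim_def)
  have Dc: "D \<in> carrier_mat ?N ?N"
    using D by (simp add: projector_def)
  have "(f x \<longrightarrow> 2 / 3 \<le> vnorm2 (acceptance ?N *\<^sub>v run_alg n (2 * (m + 1)) (gates n (m + 1) (angle A) D (steps A)) x))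
    \<and> (\<not> f x \<longrightarrow> 2 / 3 \<le> vnorm2 ((1\<^sub>m (2 * ?N) - acceptance ?N) *\<^sub>v
        run_alg n (2 * (m + 1)) (gates n (m + 1) (angle A) D (steps A)) x))" if x: "x \<in> X" for x
  proof -
    define V where "V = rabi ?N (angle A) (reflection ?N D * input_sign n (m + 1) x)"
    have Vc: "V ^\<^sub>m steps A \<in> carrier_mat (2 * ?N) (2 * ?N)"
      by (simp add: V_def)
    obtain p q where pq: "p \<in> carrier_vec ?N" "q \<in> carrier_vec ?N"
        "V ^\<^sub>m steps A *\<^sub>v vec2 ?N ?u (0\<^sub>v ?N) = vec2 ?N p q"
      by (rule vec2_cases [OF mult_mat_vec_carrier [OF Vc vec2_carrier]])
    have run: "run_alg n (2 * (m + 1)) (gates n (m + 1) (angle A) D (steps A)) x = vec2 ?N p q"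
      using run_alg_gates [of "m + 1" n D "angle A" "steps A" x] n Dc pq(3) by (simp add: V_def)
    have dx: "\<forall>i<n. dim_vec (v x i) = m" and sx: "(\<Sum>i<n. vnorm2 (v x i)) \<le> A"
      using dim sz x by auto
    have "2 / 3 \<le> vnorm2 q" if "f x"
      by (rule resonant_success [OF A D input_sign_unitary emb_carrier input_sign_emb_psi
            unit_vec_carrier vnorm2_unit_vec [OF N] emb_psi_near [of n A v x m, OF n A dx sx]
            one [OF x that] pq [unfolded V_def]])
    moreover have "2 / 3 \<le> vnorm2 p" if "\<not> f x"
      by (rule off_resonant_success [OF A D input_sign_unitary input_sign_square emb_carrier
            vnorm_emb_phi [of n A v x m, OF n A dx] unit_vec_carrier vnorm2_unit_vec [OF N] input_sign_emb_phi [OF n]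
            _ mu_upper [of A v x n, OF A sx] zero [OF x that] pq [unfolded V_def]])
        (use mu_pos [OF A, of n v x] in simp)
    ultimately show ?thesis
      unfolding run acceptance_vec2 [OF pq(1,2)] by blast
  qed
  then show ?thesis
    using gates_unitary [OF D] acceptance_projector [of ?N]
    by (simp add: computes_def length_gates qdim_double del: mult_Suc_right)
qed

section \<open>The matrix of the states \<open>psi\<close> inside the query space\<close>

definition Mmat_emb :: "nat \<Rightarrow> nat \<Rightarrow> real \<Rightarrow> bool list set \<Rightarrow> (bool list \<Rightarrow> bool)
    \<Rightarrow> (bool list \<Rightarrow> nat \<Rightarrow> complex vec) \<Rightarrow> complex mat" where
  "Mmat_emb n m A X f v = (let ones = sorted_list_of_set {x \<in> X. f x} in
     mat (length ones) (qdim n (m + 1)) (\<lambda>(r, t). cnj (emb n m (psi n m A v (ones ! r)) $ t)))"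

lemma Mmat_emb_carrier [simp]:
  "Mmat_emb n m A X f v \<in> carrier_mat (length (sorted_list_of_set {x \<in> X. f x})) (qdim n (m + 1))"
  by (simp add: Mmat_emb_def Let_def)

text \<open>The Gram matrix of the rows survives the isometry \<open>emb\<close>. Singular values
  are defined through it, so the list \<open>s\<close> also belongs to the embedded matrix, whose
  right singular vectors lie in the query space.\<close>

lemma Mmat_emb_gram:
  assumes n: "1 \<le> n"
  shows "Mmat_emb n m A X f v * adj (Mmat_emb n m A X f v) = Mmat n m A X f v * adj (Mmat n m A X f v)"
proof (rule eq_matI)
  let ?o = "sorted_list_of_set {x \<in> X. f x}"
  fix i j assume "i < dim_row (Mmat n m A X f v * adj (Mmat n m A X f v))"
    "j < dim_col (Mmat n m A X f v * adj (Mmat n m A X f v))"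
  then have ij: "i < length ?o" "j < length ?o"
    by (simp_all add: Mmat_def Let_def)
  have "(Mmat_emb n m A X f v * adj (Mmat_emb n m A X f v)) $$ (i, j)
      = braket (emb n m (psi n m A v (?o ! i))) (emb n m (psi n m A v (?o ! j)))"
    using ij by (simp add: Mmat_emb_def Let_def scalar_prod_def braket_def lessThan_atLeast0
        carrier_vecD [OF emb_carrier, simplified])
  also have "\<dots> = braket (psi n m A v (?o ! i)) (psi n m A v (?o ! j))"
    by (rule braket_emb [OF n psi_carrier])
  also have "\<dots> = (Mmat n m A X f v * adj (Mmat n m A X f v)) $$ (i, j)"
    using ij by (simp add: Mmat_def Let_def scalar_prod_def braket_def lessThan_atLeast0
        carrier_vecD [OF psi_carrier, simplified])
  finally show "(Mmat_emb n m A X f v * adj (Mmat_emb n m A X f v)) $$ (i, j)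
    = (Mmat n m A X f v * adj (Mmat n m A X f v)) $$ (i, j)" .
qed (simp_all add: Mmat_emb_def Mmat_def Let_def)

lemma singular_values_Mmat_emb:
  "1 \<le> n \<Longrightarrow> singular_values (Mmat n m A X f v) s \<Longrightarrow> singular_values (Mmat_emb n m A X f v) s"
  by (simp add: singular_values_def Mmat_emb_gram) (simp add: Mmat_emb_def Mmat_def Let_def)

text \<open>The entries of the vector are the brackets of the states \<open>psi\<close> with
  \<open>phi\<close>, each of modulus at most \<open>eps_val\<close>, one for every \<open>x\<close>
  with \<open>f x\<close>.\<close>

lemma vnorm_Mmat_emb_phi:
  assumes n: "1 \<le> n" and X: "finite X" and y: "y \<in> X" "\<not> f y"
  shows "vnorm (Mmat_emb n m A X f v *\<^sub>v emb n m (phi n m A v y))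
    \<le> sqrt (real (card {x \<in> X. f x})) * eps_val n m A X f v"
proof -
  let ?o = "sorted_list_of_set {x \<in> X. f x}"
  let ?E = "{cmod (braket (psi n m A v x) (phi n m A v y)) | x y. x \<in> X \<and> y \<in> X \<and> f x \<and> \<not> f y}"
  have "?E \<subseteq> (\<lambda>(x, y). cmod (braket (psi n m A v x) (phi n m A v y))) ` (X \<times> X)"
    by auto
  then have fin: "finite (insert 0 ?E)"
    using X by (simp add: finite_subset)
  have le: "cmod (braket (psi n m A v x) (phi n m A v y)) \<le> eps_val n m A X f v" if "x \<in> X" "f x" for x
    unfolding eps_val_def using that y by (intro Max_ge fin) auto
  have eps0: "0 \<le> eps_val n m A X f v"
    unfolding eps_val_def by (intro Max_ge fin) auto
  have entry: "(Mmat_emb n m A X f v *\<^sub>v emb n m (phi n m A v y)) $ i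
      = braket (psi n m A v (?o ! i)) (phi n m A v y)" if "i < length ?o" for i
  proof -
    have "(Mmat_emb n m A X f v *\<^sub>v emb n m (phi n m A v y)) $ i
        = braket (emb n m (psi n m A v (?o ! i))) (emb n m (phi n m A v y))"
      using that by (simp add: Mmat_emb_def Let_def scalar_prod_def braket_def lessThan_atLeast0
          carrier_vecD [OF emb_carrier, simplified])
    then show ?thesis
      using braket_emb [OF n psi_carrier] by simp
  qed
  have "vnorm2 (Mmat_emb n m A X f v *\<^sub>v emb n m (phi n m A v y))
      = (\<Sum>i<length ?o. (cmod (braket (psi n m A v (?o ! i)) (phi n m A v y)))\<^sup>2)"
    using carrier_matD(1) [OF Mmat_emb_carrier [of n m A X f v]] unfolding vnorm2_def by (intro sum.cong) (auto simp: entry simp del: length_sorted_list_of_set index_mult_mat_vec)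
  also have "\<dots> \<le> (\<Sum>i<length ?o. (eps_val n m A X f v)\<^sup>2)"
  proof (intro sum_mono power_mono le)
    fix i assume "i \<in> {..<length ?o}"
    then have "?o ! i \<in> set ?o" by simp
    then show "?o ! i \<in> X" "f (?o ! i)"
      using X by auto
  qed simp
  also have "\<dots> = (sqrt (real (card {x \<in> X. f x})) * eps_val n m A X f v)\<^sup>2"
    using X by (simp add: power_mult_distrib)
  finally show ?thesis
    unfolding vnorm_def using eps0 by (intro real_le_lsqrt) auto
qed

section \<open>Assembly with explicit constants\<close>

theorem theorem16:
  "\<exists>C > 0. \<forall>(n::nat) (m::nat) (X::bool list set) (f::bool list \<Rightarrow> bool)
      (v::bool list \<Rightarrow> nat \<Rightarrow> complex vec) (s::real list).
    n \<ge> 1 \<longrightarrow> X \<noteq> {} \<longrightarrow> X \<subseteq> {x. length x = n} \<longrightarrow>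
    (\<forall>x\<in>X. \<forall>j<n. dim_vec (v x j) = m) \<longrightarrow>
    size_A n X v \<ge> 1 \<longrightarrow>
    singular_values (Mmat n m (size_A n X v) X f v) s \<longrightarrow>
    (\<exists>k\<in>{1..kappa s}.
       eps_val n m (size_A n X v) X f v
         \<le> 1 / sqrt (real (card {x\<in>X. f x})) *
           (sval s k / (2 * sqrt cconst * size_A n X v) - sval s (k + 1))
       \<and> sval s (k + 1) \<le> 1 / (2 * sqrt (1000 * cconst) * size_A n X v)) \<longrightarrow>
    (\<exists>W T Us P. computes n X f W T Us P \<and>
        real T \<le> C * size_A n X v \<and>
        log 2 (real (qdim n W)) \<le> C * (log 2 (real (n * m)) + 1))"
\<comment> \<open>\<open>590 = 2 * 295\<close>: two queries for each of at most
  \<open>295 * A\<close> steps. The same constant covers the qubit bound.\<close>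
proof (rule exI [of _ 590], intro conjI allI impI, simp, goal_cases)
  case (1 n m X f v s)
  note n = 1(1) and dim = 1(4) and A = 1(5) and s = 1(6)
  define A where "A = size_A n X v"
  have A1: "1 \<le> A"
    using A by (simp add: A_def)
  from 1(7) obtain k where k: "1 \<le> k" "k \<le> kappa s"
    and eps: "eps_val n m A X f v \<le> 1 / sqrt (real (card {x\<in>X. f x})) *
           (sval s k / (2 * sqrt cconst * A) - sval s (k + 1))"
    and sk: "sval s (k + 1) \<le> 1 / (2 * sqrt (1000 * cconst) * A)"
    unfolding A_def by auto
  have finX: "finite X"
    by (rule finite_subset [OF 1(3)]) (use finite_lists_length_eq [of "UNIV :: bool set" n] in simp)
  have sz: "\<forall>x\<in>X. (\<Sum>j<n. vnorm2 (v x j)) \<le> A"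
    unfolding A_def size_A_def using finX by (auto intro!: Max_ge)
  \<comment> \<open>For \<open>m = 0\<close> all the vectors are empty and the size would be 0.
    Positivity of \<open>n * m\<close> gives the logarithm its usual meaning.\<close>
  have m: "1 \<le> m"
  proof (rule ccontr)
    assume "\<not> 1 \<le> m"
    then have "m = 0"
      by simp
    then have "(\<Sum>j<n. vnorm2 (v x j)) = 0" if "x \<in> X" for x
      using that dim by (simp add: vnorm2_def)
    then have "(\<lambda>x. \<Sum>j<n. vnorm2 (v x j)) ` X = {0}"
      using 1(2) by (auto simp: image_iff)
    then have "A = 0"
      by (simp add: A_def size_A_def)
    then show False
      using A1 by simp
  qed
  let ?M = "Mmat_emb n m A X f v" and ?o = "sorted_list_of_set {x \<in> X. f x}"
  have sM: "singular_values ?M s"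
    using singular_values_Mmat_emb [OF n s] by (simp add: A_def)
  obtain D where D: "projector (qdim n (m + 1)) D"
    and D1: "\<And>u. u \<in> carrier_vec (qdim n (m + 1)) \<Longrightarrow> sval s k * vnorm (D *\<^sub>v u) \<le> vnorm (?M *\<^sub>v u)"
    and D2: "\<And>i. i < length ?o \<Longrightarrow> vnorm (D *\<^sub>v col (adj ?M) i - col (adj ?M) i) \<le> sval s (k + 1)"
    using truncated_svd_projector [OF Mmat_emb_carrier sM k] by blast
  have one: "vnorm (D *\<^sub>v emb n m (psi n m A v x) - emb n m (psi n m A v x))
      \<le> 1 / (2 * sqrt (1000 * cconst) * A)" if x: "x \<in> X" "f x" for x
  proof -
    have "x \<in> set ?o"
      using finX x by simp
    then obtain i where i: "i < length ?o" "?o ! i = x"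
      by (auto simp: in_set_conv_nth)
    have "col (adj ?M) i = emb n m (psi n m A v x)"
      using i by (intro eq_vecI) (auto simp: Mmat_emb_def Let_def carrier_vecD [OF emb_carrier, simplified])
    then show ?thesis
      using D2 [OF i(1)] sk by simp
  qed
  have zero: "vnorm (D *\<^sub>v emb n m (phi n m A v y)) \<le> 1 / (20 * A)" if y: "y \<in> X" "\<not> f y" for y
  proof -
    have len: "length s = length ?o"
      using sM by (simp add: singular_values_def Mmat_emb_def Let_def)
    have k1: "k - 1 < kappa s"
      using k by simp
    have sk0: "0 < sval s k"
      using kappa_pos [OF sM k1] k by (simp add: sval_def)
    \<comment> \<open>A positive singular value forces a row, so the division by the root of the
      number of ones is a genuine one.\<close>
    have "0 < length ?o"
      using kappa_pos(1) [OF sM k1] len by simp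
    then have c: "0 < sqrt (real (card {x\<in>X. f x}))"
      using finX by simp
    have "0 \<le> sval s (k + 1)"
      using sM by (auto simp: sval_def singular_values_def)
    moreover have "sqrt cconst = 10"
      by (simp add: cconst_def real_sqrt_unique)
    ultimately have "sval s k / (2 * sqrt cconst * A) - sval s (k + 1) \<le> sval s k / (20 * A)"
      by simp
    then have "eps_val n m A X f v \<le> 1 / sqrt (real (card {x\<in>X. f x})) * (sval s k / (20 * A))"
      using c by (intro order_trans [OF eps] mult_left_mono) auto
    then have "sqrt (real (card {x\<in>X. f x})) * eps_val n m A X f v
        \<le> sqrt (real (card {x\<in>X. f x})) * (1 / sqrt (real (card {x\<in>X. f x})) * (sval s k / (20 * A)))"
      using c by (intro mult_left_mono) auto
    also have "\<dots> = sval s k / (20 * A)"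
      using c by simp
    finally have "sqrt (real (card {x\<in>X. f x})) * eps_val n m A X f v \<le> sval s k / (20 * A)" .
    \<comment> \<open>The bound on the image of \<open>phi\<close> under \<open>?M\<close> becomes
      one on its image under \<open>D\<close> after division by \<open>sval s k\<close>, which is
      positive because \<open>k \<le> kappa s\<close>.\<close>
    then have "sval s k * vnorm (D *\<^sub>v emb n m (phi n m A v y)) \<le> sval s k * (1 / (20 * A))"
      using D1 [OF emb_carrier [of n m "phi n m A v y"]]
        vnorm_Mmat_emb_phi [where f = f and m = m and A = A and v = v, OF n finX y] by simp
    then show ?thesis
      using sk0 by (rule mult_left_le_imp_le)
  qed
  have comp: "computes n X f (2 * (m + 1)) (2 * steps A) (gates n (m + 1) (angle A) D (steps A))
      (acceptance (qdim n (m + 1)))"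
    by (rule computes_from_projector [OF n m A1 dim sz D one zero])
  have "real (2 * steps A) \<le> 590 * A"
    using steps_angle_bounds(1) [OF A1] by simp
  moreover have "log 2 (real (qdim n (2 * (m + 1)))) \<le> 590 * (log 2 (real (n * m)) + 1)"
  proof -
    have nm: "1 \<le> real n * real m"
      using n m mult_mono [of 1 "real n" 1 "real m"] by simp
    have "0 < qdim n (2 * (m + 1))"
      using n by (simp add: qdim_def)
    \<comment> \<open>The dimension is \<open>4 * n * (m + 1)\<close>, at most
      \<open>8 * n * m\<close> because \<open>m \<ge> 1\<close>: three qubits beyond the logarithm
      of \<open>n * m\<close>.\<close>
    moreover have "real (qdim n (2 * (m + 1))) \<le> 2 ^ 3 * (real n * real m)"
      using n m mult_left_mono [of 1 "real m" "real n"] by (simp add: qdim_def algebra_simps)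
    ultimately have "log 2 (real (qdim n (2 * (m + 1)))) \<le> log 2 (2 ^ 3 * (real n * real m))"
      using nm by simp
    also have "\<dots> = 3 + log 2 (real n * real m)"
      using nm log_pow_cancel [of 2 3] by (subst log_mult) auto
    finally have "log 2 (real (qdim n (2 * (m + 1)))) \<le> 3 + log 2 (real n * real m)" .
    moreover have "0 \<le> log 2 (real n * real m)"
      using nm by simp
    ultimately show ?thesis
      unfolding of_nat_mult by argo
  qed
  ultimately show ?case
    using comp unfolding A_def by blast
qed

end
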